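(* Let $n\ge 1$ be an odd integer, $m\ge 2$ an integer and $N = 2^m n$. Let $G = (C_n\times C_{2^m})\rtimes_\alpha C_2$ be an $SMC(n,m,2)$ in which $C_2$ acts non-trivially on $C_{2^m}$ and $\alpha(y)\equiv -1 \bmod 2^{m-1}n$. 1) If $\alpha(y)\equiv -1 \bmod N$ and $n\not\equiv 0 \bmod 3$, then $$\mathrm{Spec}_R(G) = \{2,4\} + \{2^e d_0 + d_1 - 2 \mid 1\le e\le m-1,\ (d_0,d_1)\in D(n,2)\}.$$ 2) If $\alpha(y)\equiv 2^{m-1}n-1 \bmod N$ (and thus $m\ge 3$) and $n\not\equiv 0\bmod 3$, then $$\mathrm{Spec}_R(G) = \{2^e d_0 + d_1 + 2 \mid 1\le e\le m-1,\ (d_0,d_1)\in D(n,2)\}.$$ 3) If $n\equiv 0\bmod 3$, then $\mathrm{Spec}_R(G)$ is given by the formula of 1) when $\alpha(y)\equiv -1\bmod N$, and by the formula of 2) when $\alpha(y)\equiv 2^{m-1}n-1\bmod N$, with $D(n,2)$ replaced by $D'(n,2)$ in both cases.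
   Context: For a group $G$ and $\varphi \in \mathrm{Aut}(G)$, elements $g_1,g_2\in G$ are $\varphi$-conjugate if $g_1 = g g_2 \varphi(g)^{-1}$ for some $g\in G$; the Reidemeister number $R(\varphi)$ is the number of equivalence classes of this relation, and $\mathrm{Spec}_R(G) = \{R(\varphi) \mid \varphi\in \mathrm{Aut}(G)\}$. $C_k$ denotes the cyclic group of order $k$. An $SMC(n,m,p)$ is any semidirect product $(C_n\times C_{p^m})\rtimes_\alpha C_p$ (with $n\ge1$, $m\ge 0$, $p$ prime, $\gcd(n,p)=1$, $\alpha: C_p \to \mathrm{Aut}(C_n\times C_{p^m})$ a homomorphism) where $C_p$ acts freely by automorphisms on $C_n$, i.e. the only element of $C_n$ fixed by all of $C_p$ is the identity. Put $N=np^m$ and $C_N = C_n\times C_{p^m}$; $x,y$ are fixed generators of $C_N$ and $C_p$, and $\alpha(y)$ is regarded as an integer modulo $N$ via $x^y = y^{-1}xy = x^{\alpha(y)}$. For sets $A,B$ of numbers, $A+B = \{a+b\mid a\in A, b\in B\}$. $D(n,2)$ is the set of pairs $(d_0,d_1)\in\mathbb{Z}_{\ge0}^2$ with $d_0\mid n$, $d_1\mid n$ and $\gcd(d_0,d_1)=1$; $D'(n,2)$ is the set of those pairs in $D(n,2)$ with $d_0\equiv 0\bmod 3$ or $d_1\equiv 0\bmod 3$. *)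

theory Defs
  imports
    "HOL-Algebra.Elementary_Groups"
    "HOL-Algebra.Bij"
    "HOL-Library.Extended_Nat"
    "HOL-Library.Set_Algebras"
    "HOL-Number_Theory.Cong"
begin

definition twisted_conj :: "('a, 'c) monoid_scheme \<Rightarrow> ('a \<Rightarrow> 'a) \<Rightarrow> ('a \<times> 'a) set"
  where "twisted_conj G \<phi> =
    {(g1, g2). g1 \<in> carrier G \<and> g2 \<in> carrier G \<and>
       (\<exists>g \<in> carrier G. g1 = g \<otimes>\<^bsub>G\<^esub> g2 \<otimes>\<^bsub>G\<^esub> inv\<^bsub>G\<^esub> (\<phi> g))}"

definition Reidemeister_number :: "('a, 'c) monoid_scheme \<Rightarrow> ('a \<Rightarrow> 'a) \<Rightarrow> enat"
  where "Reidemeister_number G \<phi> =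
    (let Q = carrier G // twisted_conj G \<phi> in if finite Q then enat (card Q) else \<infinity>)"

definition Spec\<^sub>R :: "('a, 'c) monoid_scheme \<Rightarrow> enat set"
  where "Spec\<^sub>R G = {Reidemeister_number G \<phi> | \<phi>. \<phi> \<in> auto G}"

text \<open>
  The external semidirect product, with the convention
  \<open>(1, k) (h, 1) (1, k)\<^sup>-\<^sup>1 = (\<alpha> k h, 1)\<close>. It is meant to be used for \<open>\<alpha> \<in> hom K (AutoGroup H)\<close>.
\<close>
definition semidirect ::
    "('a, 'c) monoid_scheme \<Rightarrow> ('b, 'd) monoid_scheme \<Rightarrow> ('b \<Rightarrow> 'a \<Rightarrow> 'a) \<Rightarrow> ('a \<times> 'b) monoid"
  where "semidirect H K \<alpha> =
    \<lparr>carrier = carrier H \<times> carrier K,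
     monoid.mult = (\<lambda>(h, k) (h', k'). (h \<otimes>\<^bsub>H\<^esub> \<alpha> k h', k \<otimes>\<^bsub>K\<^esub> k')),
     one = (\<one>\<^bsub>H\<^esub>, \<one>\<^bsub>K\<^esub>)\<rparr>"

abbreviation C :: "nat \<Rightarrow> int monoid"
  where "C k \<equiv> integer_mod_group k"

text \<open>
  The data of an \<open>SMC(n, m, p)\<close>. In the last conjunct, \<open>C\<^sub>n\<close> is the first factor of
  \<open>C\<^sub>n \<times> C\<^sub>p\<^sub>^\<^sub>m\<close>; as the two orders are coprime, it is invariant under every automorphism.
\<close>
definition SMC_action :: "nat \<Rightarrow> nat \<Rightarrow> nat \<Rightarrow> (int \<Rightarrow> int \<times> int \<Rightarrow> int \<times> int) \<Rightarrow> bool"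
  where "SMC_action n m p \<alpha> \<longleftrightarrow>
    n \<ge> 1 \<and> prime p \<and> coprime n p \<and>
    \<alpha> \<in> hom (C p) (AutoGroup (C n \<times>\<times> C (p ^ m))) \<and>
    (\<forall>h \<in> carrier (C n).
       (\<forall>k \<in> carrier (C p). \<alpha> k (h, \<one>\<^bsub>C (p ^ m)\<^esub>) = (h, \<one>\<^bsub>C (p ^ m)\<^esub>)) \<longrightarrow> h = \<one>\<^bsub>C n\<^esub>)"

definition SMC :: "nat \<Rightarrow> nat \<Rightarrow> nat \<Rightarrow> (int \<Rightarrow> int \<times> int \<Rightarrow> int \<times> int) \<Rightarrow> ((int \<times> int) \<times> int) monoid"
  where "SMC n m p \<alpha> = semidirect (C n \<times>\<times> C (p ^ m)) (C p) \<alpha>"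

definition generator :: "('a, 'c) monoid_scheme \<Rightarrow> 'a \<Rightarrow> bool"
  where "generator G x \<longleftrightarrow> x \<in> carrier G \<and> generate G {x} = carrier G"

definition D :: "nat \<Rightarrow> (nat \<times> nat) set"
  where "D n = {(d0, d1). d0 dvd n \<and> d1 dvd n \<and> gcd d0 d1 = 1}"

definition D' :: "nat \<Rightarrow> (nat \<times> nat) set"
  where "D' n = {(d0, d1) \<in> D n. [d0 = 0] (mod 3) \<or> [d1 = 0] (mod 3)}"

text \<open>
  In the first definition the natural-number subtraction does not truncate when \<open>n \<ge> 1\<close>,
  since then \<open>d0, d1 \<ge> 1\<close>.
\<close>
definition spec_dihedral :: "nat \<Rightarrow> (nat \<times> nat) set \<Rightarrow> nat set"
  where "spec_dihedral m E =
    {2, 4} + {2 ^ e * d0 + d1 - 2 | e d0 d1. 1 \<le> e \<and> e \<le> m - 1 \<and> (d0, d1) \<in> E}"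

definition spec_semidihedral :: "nat \<Rightarrow> (nat \<times> nat) set \<Rightarrow> nat set"
  where "spec_semidihedral m E =
    {2 ^ e * d0 + d1 + 2 | e d0 d1. 1 \<le> e \<and> e \<le> m - 1 \<and> (d0, d1) \<in> E}"

end

theory Submission
  imports Defs "HOL-Algebra.Multiplicative_Group"
begin

text \<open>
  Put \<open>M = N / 2\<close>. The hypothesis on \<open>a\<close> says \<open>a = s M - 1\<close> for some \<open>s\<close>: the group is dihedral when
  \<open>s\<close> is even, and the second formula of the theorem is about odd \<open>s\<close>. Non-triviality of the action on
  the Sylow 2-subgroup amounts to \<open>4 dvd s M\<close>, so \<open>a - 1\<close> is twice an odd number and
  \<open>gcd (a - 1) N = 2\<close>. Both cases can therefore be treated together, and the parity of \<open>s\<close> matters only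
  for which automorphisms exist.

  Every element is \<open>x\<^sup>i\<close> or \<open>x\<^sup>i y\<close>. As the elements \<open>x\<^sup>i y\<close> have too small an order to be images of
  \<open>x\<close>, an automorphism sends \<open>x\<close> to \<open>x\<^sup>k\<close> and \<open>y\<close> to \<open>x\<^sup>l y\<close> with \<open>k\<close> prime to \<open>N\<close>; the relation
  \<open>y\<^sup>2 = 1\<close> is preserved exactly if \<open>N dvd s M l\<close>, that is, if \<open>s l\<close> is even.

  Twisted conjugation keeps the two cosets of \<open>\<langle>x\<rangle>\<close> apart. On the exponents, \<open>x\<^sup>u\<close> acts by adding
  \<open>(1 - k) u\<close> on \<open>\<langle>x\<rangle>\<close> and \<open>(1 - a k) u\<close> on the other coset. So the classes are the orbits on
  \<open>Z / gcd (1 - k) N\<close> and \<open>Z / gcd (1 - a k) N\<close> of the involutions induced by \<open>y\<close>, which are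
  \<open>i \<mapsto> a i - l\<close> and \<open>i \<mapsto> a (i - l)\<close>. Since \<open>gcd (a - 1) N = 2\<close>, each involution has two fixed points
  if \<open>l\<close> is even and none if \<open>l\<close> is odd, whence
  \<open>R = (gcd (1 - k) N + gcd (1 - a k) N) / 2 + (if even l then 2 else 0)\<close>
  (\<open>Reidemeister_number_automorphism\<close>).

  What remains is arithmetic. Since \<open>a k\<close> is \<open>- k\<close> modulo \<open>n\<close> and modulo 4, the odd parts of the two
  gcds are \<open>gcd (1 - k) n\<close> and \<open>gcd (1 + k) n\<close>, which are coprime, and exactly one of the two gcds is
  divisible by 4. This gives the shape \<open>2\<^sup>e d0 + d1\<close> (\<open>half_gcds_shape\<close>), and the Chinese remainder
  theorem realises every such pair (\<open>half_gcds_realised\<close>). The prime 3 is special because a unit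
  modulo 3 is 1 or -1, so that 3 divides \<open>d0\<close> or \<open>d1\<close> as soon as it divides \<open>n\<close>.
\<close>

section \<open>Orbits of affine involutions on residue classes\<close>

text \<open>
  Each fixed point is an orbit of its own, and the other orbits are pairs that partition the rest.
\<close>

lemma card_orbits_involution:
  assumes "finite A" and "\<And>x. x \<in> A \<Longrightarrow> f x \<in> A" and inv: "\<And>x. x \<in> A \<Longrightarrow> f (f x) = x"
  shows "2 * card ((\<lambda>x. {x, f x}) ` A) = card A + card {x \<in> A. f x = x}"
proof -
  define F where "F = {x \<in> A. f x = x}"
  have fin: "finite F" "finite (A - F)" using assms(1) by (auto simp: F_def)
  have maps: "f x \<in> A - F" if "x \<in> A - F" for x
    using that assms(2,3) unfolding F_def by force
  have 1: "card ((\<lambda>x. {x, f x}) ` F) = card F"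
    by (rule card_image) (auto simp: inj_on_def F_def)
  have U: "\<Union> ((\<lambda>x. {x, f x}) ` (A - F)) = A - F"
    using maps by auto
  have 2: "2 * card ((\<lambda>x. {x, f x}) ` (A - F)) = card (\<Union> ((\<lambda>x. {x, f x}) ` (A - F)))"
  proof (rule card_partition)
    show "finite ((\<lambda>x. {x, f x}) ` (A - F))" using fin by simp
    show "finite (\<Union> ((\<lambda>x. {x, f x}) ` (A - F)))" unfolding U by (rule fin)
    show "card c = 2" if "c \<in> (\<lambda>x. {x, f x}) ` (A - F)" for c
    proof -
      from that obtain x where "c = {x, f x}" "f x \<noteq> x" by (auto simp: F_def)
      then show ?thesis by simp
    qed
    show "c \<inter> d = {}" if c: "c \<in> (\<lambda>x. {x, f x}) ` (A - F)" and d: "d \<in> (\<lambda>x. {x, f x}) ` (A - F)"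
      and "c \<noteq> d" for c d
    proof -
      have orbit: "e = {z, f z}" if "e \<in> (\<lambda>x. {x, f x}) ` (A - F)" "z \<in> e" for e z
      proof -
        from that obtain x where "x \<in> A" "e = {x, f x}" by blast
        then show ?thesis using that(2) inv[of x] by (metis insertE insert_commute singletonD)
      qed
      show ?thesis
      proof (rule ccontr)
        assume "c \<inter> d \<noteq> {}"
        then obtain z where "z \<in> c" "z \<in> d" by blast
        then have "c = d" using orbit[OF c] orbit[OF d] by blast
        then show False using \<open>c \<noteq> d\<close> by contradiction
      qed
    qed
  qed
  have 3: "(\<lambda>x. {x, f x}) ` A = (\<lambda>x. {x, f x}) ` F \<union> (\<lambda>x. {x, f x}) ` (A - F)"
    by (auto simp: F_def)
  have 4: "(\<lambda>x. {x, f x}) ` F \<inter> (\<lambda>x. {x, f x}) ` (A - F) = {}"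
    by (auto simp: F_def)
  have "card ((\<lambda>x. {x, f x}) ` A) = card F + card ((\<lambda>x. {x, f x}) ` (A - F))"
    unfolding 3 using fin 1 4 by (simp add: card_Un_disjoint)
  moreover have "card A = card F + card (A - F)"
    using assms(1) by (simp add: F_def card_Diff_subset card_mono)
  ultimately show ?thesis using 2 U F_def by simp
qed

text \<open>
  Write \<open>a - 1 = 2 b\<close> with \<open>b\<close> a unit modulo \<open>h\<close>. The equation \<open>2 b i + c = 0\<close> modulo \<open>2 h\<close> has no solution
  for odd \<open>c\<close>; for even \<open>c\<close> it prescribes \<open>i\<close> modulo \<open>h\<close>, and a residue modulo \<open>h\<close> has two lifts.
\<close>

lemma card_fixed_points_affine:
  fixes h :: nat and a c :: int
  assumes "h > 0" and "gcd (a - 1) (2 * int h) = 2"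
  shows "card {i \<in> {0..<2 * int h}. (a * i + c) mod (2 * int h) = i} = (if even c then 2 else 0)"
proof -
  obtain b where b: "a - 1 = 2 * b"
    using assms(2) by (metis dvdE gcd_dvd1)
  have "2 * gcd b (int h) = 2"
    using assms(2) unfolding b gcd_mult_distrib_int[of 2, symmetric] by simp
  then have cop: "coprime b (int h)" by (simp add: coprime_iff_gcd_eq_1)
  have fixed: "(a * i + c) mod (2 * int h) = i \<longleftrightarrow> 2 * int h dvd 2 * (b * i) + c"
    if "i \<in> {0..<2 * int h}" for i
  proof -
    have "(a * i + c) mod (2 * int h) = i \<longleftrightarrow> [a * i + c = i] (mod (2 * int h))"
      using that by (simp add: cong_def)
    also have "\<dots> \<longleftrightarrow> 2 * int h dvd (a - 1) * i + c"
      by (simp add: cong_iff_dvd_diff algebra_simps)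
    finally show ?thesis by (simp add: b mult.assoc)
  qed
  show ?thesis
  proof (cases "even c")
    case False
    have "\<not> 2 * int h dvd 2 * (b * i) + c" for i
      using False by (metis dvd_mult_left dvd_add_right_iff dvd_triv_left)
    then have "{i \<in> {0..<2 * int h}. (a * i + c) mod (2 * int h) = i} = {}"
      using fixed by blast
    then show ?thesis using False by (simp only: card.empty if_False)
  next
    case True
    then obtain c' where c': "c = 2 * c'" by blast
    obtain b' where b': "[b * b' = 1] (mod int h)"
      using cong_solve_coprime_int[OF cop] by blast
    define t where "t = (- b' * c') mod int h"
    have t: "0 \<le> t" "t < int h" using assms(1) by (auto simp: t_def)
    have sol: "2 * int h dvd 2 * (b * i) + c \<longleftrightarrow> [i = t] (mod int h)" for i
    proof -
      have "2 * int h dvd 2 * (b * i) + c \<longleftrightarrow> [b * i = - c'] (mod int h)"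
        unfolding c' distrib_left[symmetric] dvd_mult_cancel_left by (simp add: cong_iff_dvd_diff)
      also have "\<dots> \<longleftrightarrow> [b * i = b * (- b' * c')] (mod int h)"
      proof -
        have "[b * b' * (- c') = 1 * (- c')] (mod int h)" by (rule cong_scalar_right[OF b'])
        then have "[b * (- b' * c') = - c'] (mod int h)" by (simp add: mult.assoc)
        then show ?thesis using cong_trans cong_sym by blast
      qed
      also have "\<dots> \<longleftrightarrow> [i = - b' * c'] (mod int h)"
        by (rule cong_mult_lcancel[OF cop])
      finally show ?thesis by (simp add: t_def)
    qed
    have "{i \<in> {0..<2 * int h}. (a * i + c) mod (2 * int h) = i} = {t, t + int h}"
    proof (intro equalityI subsetI)
      fix i assume "i \<in> {i \<in> {0..<2 * int h}. (a * i + c) mod (2 * int h) = i}"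
      then have i: "0 \<le> i" "i < 2 * int h" "[i = t] (mod int h)"
        using fixed[of i] sol[of i] by auto
      show "i \<in> {t, t + int h}"
      proof (cases "i < int h")
        case True
        then show ?thesis using i t cong_less_imp_eq_int[of i "int h" t] by simp
      next
        case False
        have "[i - int h = t] (mod int h)" using i(3) by (simp add: cong_def)
        then show ?thesis using False i t cong_less_imp_eq_int[of "i - int h" "int h" t] by simp
      qed
    next
      fix i assume "i \<in> {t, t + int h}"
      then have "i \<in> {0..<2 * int h}" "[i = t] (mod int h)"
        using t by (auto simp: cong_def)
      then show "i \<in> {i \<in> {0..<2 * int h}. (a * i + c) mod (2 * int h) = i}"
        using fixed[of i] sol[of i] by blast
    qed
    then show ?thesis using True assms(1) by simp
  qed
qed

lemma card_range_eq:
  assumes "\<And>i j. F i = F j \<longleftrightarrow> H i = H j"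
  shows "card (range F) = card (range H)"
proof -
  define \<theta> where "\<theta> = (\<lambda>z. H (inv_into UNIV F z))"
  have *: "\<theta> (F i) = H i" for i
    unfolding \<theta>_def using assms f_inv_into_f[of "F i" F UNIV] by blast
  have "\<theta> ` range F = range H" by (simp add: image_image *)
  moreover have "inj_on \<theta> (range F)"
  proof (rule inj_onI)
    fix y z assume "y \<in> range F" "z \<in> range F" "\<theta> y = \<theta> z"
    then show "y = z" using assms * by auto
  qed
  ultimately show ?thesis using card_image by metis
qed

text \<open>
  The congruences for \<open>a * a\<close> and \<open>(a + 1) * c\<close> say that \<open>i \<mapsto> a i + c\<close> is an involution of \<open>Z / 2 h\<close>,
  and \<open>F\<close> is any complete invariant of its orbits.
\<close>

lemma card_affine_involution_classes:
  fixes h :: nat and a c :: int and F :: "int \<Rightarrow> 'b"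
  assumes "h > 0" and gcd2: "gcd (a - 1) (2 * int h) = 2"
    and sq: "[a * a = 1] (mod 2 * int h)" and ac: "[(a + 1) * c = 0] (mod 2 * int h)"
    and F: "\<And>i j. F i = F j \<longleftrightarrow> [i = j] (mod 2 * int h) \<or> [i = a * j + c] (mod 2 * int h)"
  shows "finite (range F)" and "card (range F) = h + (if even c then 1 else 0)"
proof -
  define g where "g = 2 * int h"
  have g: "g > 0" using assms(1) by (simp add: g_def)
  define f where "f = (\<lambda>i. (a * i + c) mod g)"
  define orb where "orb = (\<lambda>i. {i mod g, f (i mod g)})"
  have ff: "[a * (a * i + c) + c = i] (mod g)" for i
  proof -
    have "a * (a * i + c) + c = a * a * i + (a + 1) * c" by (simp add: algebra_simps)
    moreover have "[a * a * i + (a + 1) * c = 1 * i + 0] (mod g)"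
      using sq ac unfolding g_def[symmetric] by (intro cong_add cong_scalar_right)
    ultimately show ?thesis by simp
  qed
  have fm: "f (i mod g) = f i" for i
    unfolding f_def by (metis mod_add_left_eq mod_mult_right_eq)
  have f_inv: "f (f i) = i mod g" for i
  proof -
    have "f (f i) = f (a * i + c)" using fm[of "a * i + c"] by (simp add: f_def)
    then show ?thesis using ff[of i] by (simp add: f_def cong_def)
  qed
  have f_in: "f i \<in> {0..<g}" for i using g by (simp add: f_def)
  have orb_eq: "orb i = orb j \<longleftrightarrow> F i = F j" for i j
  proof -
    have "orb i = orb j \<longleftrightarrow> i mod g = j mod g \<or> i mod g = f j"
    proof
      assume "orb i = orb j"
      then have "i mod g \<in> orb j" unfolding orb_def by blast
      then show "i mod g = j mod g \<or> i mod g = f j" by (simp add: orb_def fm)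
    next
      assume "i mod g = j mod g \<or> i mod g = f j"
      then show "orb i = orb j"
      proof
        assume "i mod g = f j"
        then have "f (i mod g) = j mod g" by (simp only: f_inv)
        then have "f i = j mod g" by (simp only: fm)
        then show ?thesis using \<open>i mod g = f j\<close> by (simp add: orb_def fm insert_commute)
      qed (simp only: orb_def)
    qed
    then show ?thesis by (simp add: F cong_def f_def g_def)
  qed
  have orb_range: "range orb = (\<lambda>i. {i, f i}) ` {0..<g}"
  proof -
    have "range (\<lambda>i::int. i mod g) = {0..<g}"
    proof (intro equalityI subsetI)
      fix i assume "i \<in> {0..<g}"
      then show "i \<in> range (\<lambda>i. i mod g)" by (intro image_eqI[of _ _ i]) auto
    qed (use g in auto)
    then have "(\<lambda>i. {i, f i}) ` {0..<g} = (\<lambda>i. {i, f i}) ` range (\<lambda>i::int. i mod g)" by simp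
    also have "\<dots> = range orb" unfolding image_image orb_def ..
    finally show ?thesis ..
  qed
  have "2 * card (range orb) = card {0..<g} + card {i \<in> {0..<g}. f i = i}"
    unfolding orb_range by (rule card_orbits_involution) (use f_in f_inv in auto)
  also have "card {i \<in> {0..<g}. f i = i} = (if even c then 2 else 0)"
    unfolding f_def g_def by (rule card_fixed_points_affine[OF assms(1,2)])
  finally have "card (range orb) = h + (if even c then 1 else 0)"
    by (simp add: g_def nat_mult_distrib split: if_splits)
  moreover have "card (range F) = card (range orb)"
    using orb_eq by (intro card_range_eq) auto
  ultimately show c: "card (range F) = h + (if even c then 1 else 0)" by simp
  show "finite (range F)"
    using c assms(1) by (intro card_ge_0_finite) simp
qed

section \<open>Prescribing the gcds of \<open>k - 1\<close> and \<open>k + 1\<close> with the modulus\<close>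

text \<open>
  \<open>B\<close> is the largest divisor of \<open>n\<close> prime to \<open>d\<close>, and \<open>A\<close> collects the prime powers in \<open>n\<close> of the primes dividing \<open>d\<close>.
\<close>

lemma split_off_primes:
  fixes n d :: nat
  assumes "n > 0"
  obtains A B where "n = A * B" and "coprime d B" and "\<And>p. prime p \<Longrightarrow> p dvd A \<Longrightarrow> p dvd d"
proof -
  have "\<exists>A B. n = A * B \<and> coprime d B \<and> (\<forall>p. prime p \<longrightarrow> p dvd A \<longrightarrow> p dvd d)"
    using assms
  proof (induction n rule: less_induct)
    case (less n)
    show ?case
    proof (cases "coprime d n")
      case True
      then show ?thesis by (intro exI[of _ 1] exI[of _ n]) auto
    next
      case False
      then obtain p where p: "prime p" "p dvd d" "p dvd n"
        by (metis coprime_iff_gcd_eq_1 gcd_dvd1 gcd_dvd2 dvd_trans prime_factor_nat)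
      then obtain n' where n': "n = p * n'" by blast
      have "n' < n" "n' > 0" using n' less.prems prime_gt_1_nat[OF p(1)] by auto
      then obtain A B where AB: "n' = A * B" "coprime d B" "\<forall>p. prime p \<longrightarrow> p dvd A \<longrightarrow> p dvd d"
        using less.IH by blast
      show ?thesis
        by (intro exI[of _ "p * A"] exI[of _ B]) (use AB n' p in \<open>auto simp: prime_dvd_mult_iff dest: primes_dvd_imp_eq\<close>)
    qed
  qed
  then show thesis using that by blast
qed

lemma coprime_if_no_common_prime:
  fixes a :: int and b :: nat
  assumes "\<And>p::nat. prime p \<Longrightarrow> p dvd b \<Longrightarrow> \<not> int p dvd a"
  shows "coprime a (int b)"
proof (rule ccontr)
  assume "\<not> coprime a (int b)"
  then have "gcd (nat \<bar>a\<bar>) b \<noteq> 1"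
    by (metis coprime_iff_gcd_eq_1 gcd_int_int_eq gcd_abs1_int int_nat_eq abs_ge_zero of_nat_1)
  then obtain p where "prime p" "p dvd gcd (nat \<bar>a\<bar>) b" using prime_factor_nat by blast
  then have "p dvd nat \<bar>a\<bar>" "p dvd b" by (auto simp del: gcd_nat_abs_left_eq)
  then show False using assms[of p] \<open>prime p\<close> by (simp add: nat_abs_dvd_iff dvd_nat_abs_iff)
qed

lemma gcd_coprime_mult_int:
  fixes u b c :: int
  assumes "coprime b c"
  shows "gcd u (b * c) = gcd u b * gcd u c"
proof (rule zdvd_antisym_nonneg)
  obtain b' c' where bc: "gcd u (b * c) = b' * c'" "b' dvd b" "c' dvd c"
    using division_decomp[of "gcd u (b * c)" b c] by auto
  have "b' * c' dvd u" using gcd_dvd1[of u "b * c"] bc(1) by simp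
  then have "b' dvd u" "c' dvd u" by (auto dest: dvd_mult_left dvd_mult_right)
  then show "gcd u (b * c) dvd gcd u b * gcd u c"
    unfolding bc(1) using bc(2,3) by (intro mult_dvd_mono gcd_greatest)
  have "coprime (gcd u b) (gcd u c)"
    using assms by (meson coprime_divisors gcd_dvd2)
  then show "gcd u b * gcd u c dvd gcd u (b * c)"
    by (intro divides_mult) (auto intro: dvd_mult dvd_mult2)
qed auto

lemma gcd_twice_odd:
  fixes u :: int and m n :: nat
  assumes "odd n" and "m \<ge> 1" and "u mod 4 = 2"
  shows "gcd u (2 ^ m * int n) = 2 * gcd u (int n)"
proof -
  define v where "v = u div 2"
  have v: "u = 2 * v" "odd v" using assms(3) unfolding v_def by presburger+
  have "(2::int) ^ m = 2 * 2 ^ (m - 1)" using assms(2) by (simp add: power_eq_if)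
  then have "gcd u (2 ^ m) = 2 * gcd v (2 ^ (m - 1))"
    using gcd_mult_distrib_int[of 2 v "2 ^ (m - 1)"] v(1) by simp
  also have "gcd v (2 ^ (m - 1)) = 1" using v(2) by simp
  finally have "gcd u (2 ^ m) = 2" by simp
  moreover have "coprime (2 ^ m :: int) (int n)" using assms(1) by simp
  ultimately show ?thesis by (simp add: gcd_coprime_mult_int)
qed

lemma gcd_multiple_of_four:
  fixes u :: int and m n :: nat
  assumes "odd n" and "m \<ge> 2" and "4 dvd u"
  obtains e where "1 \<le> e" "e \<le> m - 1" "gcd u (2 ^ m * int n) = 2 * (2 ^ e * gcd u (int n))"
proof -
  have "int (nat (gcd u (2 ^ m))) dvd int (2 ^ m)" by simp
  then have "nat (gcd u (2 ^ m)) dvd 2 ^ m" by (simp only: int_dvd_int_iff)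
  then obtain f where f: "f \<le> m" "nat (gcd u (2 ^ m)) = 2 ^ f"
    using divides_primepow_nat[of 2 _ m] two_is_prime_nat by blast
  then have g: "gcd u (2 ^ m) = 2 ^ f"
    by (simp add: nat_eq_iff)
  have "(2::int) ^ 2 dvd 2 ^ m" using assms(2) by (rule le_imp_power_dvd)
  then have four: "(2::int) ^ 2 dvd 2 ^ f"
    unfolding g[symmetric] using assms(3) by (intro gcd_greatest) auto
  have "2 \<le> f"
    using four dvd_power_iff[of "2::int" 2 f] by simp
  have "coprime (2 ^ m :: int) (int n)" using assms(1) by simp
  then have "gcd u (2 ^ m * int n) = 2 ^ f * gcd u (int n)"
    using g by (simp add: gcd_coprime_mult_int)
  moreover obtain e where "f = Suc e" using \<open>2 \<le> f\<close> by (cases f) auto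
  ultimately show thesis using that[of e] f(1) \<open>2 \<le> f\<close> by simp
qed

text \<open>
  Split \<open>n = A B Q\<close> according to whether a prime divides \<open>d0\<close>, \<open>d1\<close> or neither, and prescribe \<open>t\<close> as
  \<open>d0\<close> modulo \<open>A\<close>, as \<open>d1 - 2\<close> modulo \<open>B\<close> and as 1 modulo \<open>Q\<close>. Modulo a prime of \<open>A\<close>, \<open>B\<close> or \<open>Q\<close> the
  numbers \<open>t\<close>, \<open>t + 1\<close>, \<open>t + 2\<close> are then \<open>0, 1, 2\<close> or \<open>-2, -1, 0\<close> or \<open>1, 2, 3\<close>. So the oddness of \<open>n\<close>
  is what makes the non-zero ones units modulo \<open>A\<close> and \<open>B\<close>, and modulo \<open>Q\<close> also the prime 3 has to be excluded,
  which is the purpose of \<open>three\<close>.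
\<close>

lemma exists_prescribed_gcds:
  fixes n d0 d1 :: nat
  assumes "odd n" and "d0 dvd n" and "d1 dvd n" and "coprime d0 d1"
    and three: "3 dvd n \<Longrightarrow> 3 dvd d0 \<or> 3 dvd d1"
  obtains t :: int where "gcd t (int n) = int d0" "gcd (t + 2) (int n) = int d1" "coprime (t + 1) (int n)"
proof -
  have "n > 0" using assms(1) by (simp add: odd_pos)
  then obtain A R where AR: "n = A * R" "coprime d0 R" "\<And>p. prime p \<Longrightarrow> p dvd A \<Longrightarrow> p dvd d0"
    using split_off_primes[of n d0] by blast
  then have "R > 0" using \<open>n > 0\<close> by simp
  then obtain B Q where BQ: "R = B * Q" "coprime d1 Q" "\<And>p. prime p \<Longrightarrow> p dvd B \<Longrightarrow> p dvd d1"
    using split_off_primes[of R d1] by blast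
  have n: "n = A * (B * Q)" using AR(1) BQ(1) by simp
  have odd_prime: "\<not> int p dvd 2" "\<not> int p dvd 1" if "prime p" "p dvd n" for p
  proof -
    have "p \<noteq> 2" using assms(1) that(2) by auto
    then have "\<not> p dvd 2" using that(1) primes_dvd_imp_eq two_is_prime_nat by blast
    then show "\<not> int p dvd 2" using int_dvd_int_iff[of p 2] by simp
    show "\<not> int p dvd 1" using that(1) by auto
  qed
  have Q3: "\<not> int p dvd 3" if "prime p" "p dvd Q" for p
  proof
    assume "int p dvd 3"
    then have "p dvd 3" using int_dvd_int_iff[of p 3] by simp
    moreover have "prime (3::nat)" by simp
    ultimately have "p = 3" using that(1) primes_dvd_imp_eq by blast
    moreover have "\<not> p dvd d0" "\<not> p dvd d1"
      using that AR(2) BQ(1,2) by (metis coprime_common_divisor dvd_mult not_prime_unit)+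
    ultimately show False using three that(2) n by auto
  qed
  have cop_dR: "coprime (int A) (int R)"
  proof (rule coprime_if_no_common_prime)
    show "\<not> int p dvd int A" if "prime p" "p dvd R" for p
      using that AR(2,3) by (metis coprime_common_divisor int_dvd_int_iff not_prime_unit)
  qed
  have cop_BQ: "coprime (int B) (int Q)"
  proof (rule coprime_if_no_common_prime)
    show "\<not> int p dvd int B" if "prime p" "p dvd Q" for p
      using that BQ(2,3) by (metis coprime_common_divisor int_dvd_int_iff not_prime_unit)
  qed
  have "coprime (int d1) (int A)"
  proof (rule coprime_if_no_common_prime)
    show "\<not> int p dvd int d1" if "prime p" "p dvd A" for p
      using that AR(3) assms(4) by (metis coprime_common_divisor int_dvd_int_iff not_prime_unit)
  qed
  then have d1B: "d1 dvd B"
    using assms(3) BQ(2) by (simp add: n coprime_dvd_mult_right_iff coprime_dvd_mult_left_iff)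
  have d0A: "d0 dvd A"
    using assms(2) AR(1,2) by (simp add: coprime_dvd_mult_left_iff)
  obtain r where r: "[r = int d1 - 2] (mod int B)" "[r = 1] (mod int Q)"
    using binary_chinese_remainder_int[OF cop_BQ] by blast
  obtain t where t: "[t = int d0] (mod int A)" "[t = r] (mod int R)"
    using binary_chinese_remainder_int[OF cop_dR] by blast
  have tB: "[t = int d1 - 2] (mod int B)" and tQ: "[t = 1] (mod int Q)"
    using t(2) r cong_trans unfolding BQ(1) by (metis cong_modulus_mult mult.commute of_nat_mult)+
  have pA: "int p dvd t" if "prime p" "p dvd A" for p
    using t(1) AR(3)[OF that] that(2)
    by (metis cong_dvd_iff cong_dvd_modulus int_dvd_int_iff)
  have pB: "int p dvd t + 2" if "prime p" "p dvd B" for p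
  proof -
    have "[t + 2 = int d1 - 2 + 2] (mod int p)"
      using tB that(2) by (meson cong_add cong_dvd_modulus cong_refl int_dvd_int_iff)
    then show ?thesis using BQ(3)[OF that] by (simp add: cong_dvd_iff)
  qed
  have pQ: "int p dvd t - 1" if "p dvd Q" for p
    using tQ that by (meson cong_iff_dvd_diff dvd_trans int_dvd_int_iff)
  have pn: "p dvd n" if "p dvd A \<or> p dvd B \<or> p dvd Q" for p using that n by auto
  have copA: "coprime (t + 1) (int A)" "coprime (t + 2) (int A)"
    by (rule coprime_if_no_common_prime; use pA pn odd_prime in \<open>metis dvd_add_right_iff\<close>)+
  have copB: "coprime t (int B)" "coprime (t + 1) (int B)"
  proof -
    show "coprime t (int B)"
      by (rule coprime_if_no_common_prime) (use pB pn odd_prime in \<open>metis dvd_add_right_iff\<close>)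
    show "coprime (t + 1) (int B)"
    proof (rule coprime_if_no_common_prime)
      show "\<not> int p dvd t + 1" if "prime p" "p dvd B" for p
        using dvd_diff[OF pB[OF that], of "t + 1"] odd_prime(2)[OF that(1)] pn that(2) by auto
    qed
  qed
  have copQ: "coprime t (int Q)" "coprime (t + 1) (int Q)" "coprime (t + 2) (int Q)"
  proof -
    have *: "\<not> int p dvd t + (j - 1)" if "prime p" "p dvd Q" "j \<in> {1,2,3}" for p and j :: int
    proof
      assume "int p dvd t + (j - 1)"
      from dvd_diff[OF this pQ[OF that(2)]] have "int p dvd j" by simp
      then show False using that odd_prime[OF that(1)] pn Q3 by blast
    qed
    show "coprime t (int Q)" "coprime (t + 1) (int Q)" "coprime (t + 2) (int Q)"
      by (rule coprime_if_no_common_prime; use *[of _ 1] *[of _ 2] *[of _ 3] in simp)+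
  qed
  have gcd_n: "gcd u (int n) = gcd u (int A) * (gcd u (int B) * gcd u (int Q))" for u
    using cop_dR cop_BQ by (simp add: n BQ(1) gcd_coprime_mult_int)
  have "gcd t (int A) = int d0"
    using cong_gcd_eq[OF t(1)] d0A by (simp add: gcd_nat.absorb1)
  then have 1: "gcd t (int n) = int d0" unfolding gcd_n using copB copQ by simp
  have "[t + 2 = int d1 - 2 + 2] (mod int B)" using tB by (intro cong_add) auto
  then have "gcd (t + 2) (int B) = int d1"
    using d1B cong_gcd_eq by fastforce
  then have 2: "gcd (t + 2) (int n) = int d1" unfolding gcd_n using copA copQ by simp
  have "coprime (t + 1) (int n)" using copA copB copQ by (simp add: n)
  with 1 2 show thesis using that by blast
qed

text \<open>
  For odd \<open>n\<close>, the pairs \<open>(gcd (1 - k) n, gcd (1 + k) n)\<close> with \<open>k\<close> prime to \<open>n\<close>: if 3 divides \<open>n\<close>, then \<open>k\<close> is 1 or -1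
  modulo 3, and one of the two entries is divisible by 3.
\<close>

definition admissible_pairs :: "nat \<Rightarrow> (nat \<times> nat) set"
  where "admissible_pairs n = (if [n = 0] (mod 3) then D' n else D n)"

lemma admissible_pairs_iff:
  "(d0, d1) \<in> admissible_pairs n \<longleftrightarrow>
    d0 dvd n \<and> d1 dvd n \<and> coprime d0 d1 \<and> (3 dvd n \<longrightarrow> 3 dvd d0 \<or> 3 dvd d1)"
  by (auto simp: admissible_pairs_def D_def D'_def cong_0_iff coprime_iff_gcd_eq_1)

text \<open>
  Since \<open>a\<close> is -1 modulo \<open>n\<close> and \<open>a + 1\<close> is divisible by 4, multiplication by \<open>a\<close> acts as negation modulo both moduli.
\<close>

lemma twist_congruences:
  fixes n m :: nat and a s k :: int
  assumes "a = s * (2 ^ (m - 1) * int n) - 1" and "4 dvd s * (2 ^ (m - 1) * int n)" and "odd k"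
  shows "gcd (1 - a * k) (int n) = gcd (1 + k) (int n)"
    and "(1 - a * k) mod 4 = (1 + k) mod 4"
proof -
  have eq: "1 - a * k = 1 + k - s * (2 ^ (m - 1) * int n) * k"
    unfolding assms(1) by (simp add: algebra_simps)
  have "[1 - a * k = 1 + k - 0] (mod int n)"
    unfolding eq by (intro cong_diff cong_refl) (simp add: cong_0_iff)
  then show "gcd (1 - a * k) (int n) = gcd (1 + k) (int n)"
    using cong_gcd_eq by fastforce
  have "[1 - a * k = 1 + k - 0] (mod 4)"
    unfolding eq by (intro cong_diff cong_refl) (use assms(2) in \<open>simp add: cong_0_iff\<close>)
  then show "(1 - a * k) mod 4 = (1 + k) mod 4" by (simp add: cong_def)
qed

text \<open>
  One of \<open>1 - k\<close> and \<open>1 - a * k\<close> is 2 modulo 4 and contributes an odd half gcd, namely \<open>d1\<close>; the other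
  one is divisible by 4 and contributes \<open>2 ^ e * d0\<close>. Which of them is which depends on \<open>k\<close> modulo 4, and
  the symmetry of \<open>admissible_pairs n\<close> absorbs the swap.
\<close>

lemma half_gcds_shape:
  fixes n m :: nat and a s k :: int
  assumes n: "odd n" and m: "m \<ge> 2"
    and a: "a = s * (2 ^ (m - 1) * int n) - 1" and four: "4 dvd s * (2 ^ (m - 1) * int n)"
    and k: "coprime k (2 ^ m * int n)"
  obtains e d0 d1 h0 h1 :: nat where "1 \<le> e" "e \<le> m - 1" "(d0, d1) \<in> admissible_pairs n"
    "gcd (1 - k) (2 ^ m * int n) = 2 * int h0" "gcd (1 - a * k) (2 ^ m * int n) = 2 * int h1"
    "h0 + h1 = 2 ^ e * d0 + d1"
proof -
  define c0 where "c0 = nat (gcd (1 - k) (int n))"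
  define c1 where "c1 = nat (gcd (1 + k) (int n))"
  have c: "int c0 = gcd (1 - k) (int n)" "int c1 = gcd (1 + k) (int n)"
    by (simp_all add: c0_def c1_def)
  have kn: "coprime k (int n)" and "odd k"
    using k m by (auto simp: coprime_right_2_iff_odd)
  have "coprime c0 c1"
  proof (rule coprimeI)
    fix d assume "d dvd c0" "d dvd c1"
    then have "int d dvd gcd (1 - k) (int n)" "int d dvd gcd (1 + k) (int n)"
      unfolding c[symmetric] by simp_all
    then have d: "int d dvd 1 - k" "int d dvd 1 + k" "d dvd n" by auto
    have "int d dvd 2" using dvd_add[OF d(1,2)] by simp
    then have "d dvd 2" using int_dvd_int_iff[of d 2] by simp
    moreover have "odd d" using d(3) n dvd_trans by blast
    ultimately show "is_unit d"
      using coprime_common_divisor[of d 2 d] by (simp add: coprime_right_2_iff_odd)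
  qed
  moreover have "c0 dvd n" "c1 dvd n"
    using c int_dvd_int_iff by (metis gcd_dvd2)+
  moreover have "3 dvd c0 \<or> 3 dvd c1" if "3 dvd n"
  proof -
    have n3: "(3::int) dvd int n" using that int_dvd_int_iff[of 3 n] by simp
    have "\<not> 3 dvd k" using kn n3 coprime_common_divisor[of k "int n" 3] by auto
    then have "3 dvd 1 - k \<or> 3 dvd 1 + k" by presburger
    then have "3 dvd int c0 \<or> 3 dvd int c1" using n3 unfolding c by auto
    then show ?thesis using int_dvd_int_iff[of 3 c0] int_dvd_int_iff[of 3 c1] by simp
  qed
  ultimately have E: "(c0, c1) \<in> admissible_pairs n" "(c1, c0) \<in> admissible_pairs n"
    by (auto simp: admissible_pairs_iff coprime_commute)
  note tw = twist_congruences[OF a four \<open>odd k\<close>]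
  have "k mod 4 = 1 \<or> k mod 4 = 3" using \<open>odd k\<close> by presburger
  then show thesis
  proof
    assume "k mod 4 = 1"
    then have "4 dvd 1 - k" "(1 - a * k) mod 4 = 2" unfolding tw(2) by presburger+
    then obtain e where e: "1 \<le> e" "e \<le> m - 1"
      "gcd (1 - k) (2 ^ m * int n) = 2 * (2 ^ e * gcd (1 - k) (int n))"
      using gcd_multiple_of_four[OF n m] by blast
    have g1: "gcd (1 - a * k) (2 ^ m * int n) = 2 * gcd (1 + k) (int n)"
      using gcd_twice_odd[OF n, of m "1 - a * k"] m \<open>(1 - a * k) mod 4 = 2\<close> tw(1) by simp
    show thesis
      by (rule that[OF e(1,2) E(1), of "2 ^ e * c0" c1]) (simp_all add: e(3) g1 c)
  next
    assume "k mod 4 = 3"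
    then have "4 dvd 1 - a * k" "(1 - k) mod 4 = 2"
      using tw(2) by presburger+
    then obtain e where e: "1 \<le> e" "e \<le> m - 1"
      "gcd (1 - a * k) (2 ^ m * int n) = 2 * (2 ^ e * gcd (1 + k) (int n))"
      using gcd_multiple_of_four[OF n m, of "1 - a * k"] tw(1) by metis
    have g1: "gcd (1 - k) (2 ^ m * int n) = 2 * gcd (1 - k) (int n)"
      using gcd_twice_odd[OF n, of m "1 - k"] m \<open>(1 - k) mod 4 = 2\<close> by simp
    show thesis
      by (rule that[OF e(1,2) E(2), of c0 "2 ^ e * c1"]) (simp_all add: e(3) g1 c)
  qed
qed

text \<open>
  Take \<open>k = u + 1\<close> where \<open>u\<close> is \<open>2 ^ (e + 1)\<close> modulo \<open>2 ^ m\<close> and solves \<open>exists_prescribed_gcds\<close> modulo \<open>n\<close>.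
\<close>

lemma half_gcds_realised:
  fixes n m e d0 d1 :: nat and a s :: int
  assumes n: "odd n" and m: "m \<ge> 2"
    and a: "a = s * (2 ^ (m - 1) * int n) - 1" and four: "4 dvd s * (2 ^ (m - 1) * int n)"
    and e: "1 \<le> e" "e \<le> m - 1" and E: "(d0, d1) \<in> admissible_pairs n"
  obtains k where "coprime k (2 ^ m * int n)" "gcd (1 - k) (2 ^ m * int n) = 2 * int (2 ^ e * d0)"
    "gcd (1 - a * k) (2 ^ m * int n) = 2 * int d1"
proof -
  obtain t where t: "gcd t (int n) = int d0" "gcd (t + 2) (int n) = int d1" "coprime (t + 1) (int n)"
    using exists_prescribed_gcds[OF n] E unfolding admissible_pairs_iff by metis
  have cop: "coprime (2 ^ m :: int) (int n)" using n by simp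
  obtain u where u: "[u = 2 ^ Suc e] (mod 2 ^ m)" "[u = t] (mod int n)"
    using binary_chinese_remainder_int[OF cop] by blast
  have le: "Suc e \<le> m" using e m by simp
  have "gcd u (2 ^ m) = gcd (2 ^ Suc e) (2 ^ m)" by (rule cong_gcd_eq[OF u(1)])
  also have "\<dots> = 2 ^ Suc e"
    using le_imp_power_dvd[OF le, of "2::int"] by (simp add: gcd_proj1_iff del: power_Suc)
  finally have u2: "gcd u (2 ^ m) = 2 ^ Suc e" .
  have "(2::int) ^ 2 dvd 2 ^ Suc e" using e(1) by (intro le_imp_power_dvd) simp
  then have u4: "4 dvd u" using u2 gcd_dvd1[of u "2 ^ m"] dvd_trans by fastforce
  have un: "gcd u (int n) = int d0" using cong_gcd_eq[OF u(2)] t(1) by simp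
  have "gcd (u + 2) (int n) = int d1"
    using cong_gcd_eq[OF cong_add[OF u(2) cong_refl[of 2]]] t(2) by simp
  then have un2: "gcd (1 + (u + 1)) (int n) = int d1" by (simp add: add.commute)
  have "coprime (u + 1) (int n)"
    using cong_gcd_eq[OF cong_add[OF u(2) cong_refl[of 1]]] t(3) by (simp add: coprime_iff_gcd_eq_1)
  moreover have odd: "odd (u + 1)" using u4 by presburger
  ultimately have k: "coprime (u + 1) (2 ^ m * int n)" by (simp add: coprime_right_2_iff_odd)
  have "gcd (1 - (u + 1)) (2 ^ m * int n) = gcd u (2 ^ m * int n)" by simp
  then have g0: "gcd (1 - (u + 1)) (2 ^ m * int n) = 2 * int (2 ^ e * d0)"
    using gcd_coprime_mult_int[OF cop, of u] u2 un by simp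
  note tw = twist_congruences[OF a four odd]
  have "(1 + (u + 1)) mod 4 = 2" using u4 by presburger
  then have "gcd (1 - a * (u + 1)) (2 ^ m * int n) = 2 * gcd (1 + (u + 1)) (int n)"
    using gcd_twice_odd[OF n, of m "1 - a * (u + 1)"] m tw by simp
  then show thesis using that[OF k g0] un2 by simp
qed

section \<open>Twisted conjugacy in cyclic groups extended by an involution\<close>

text \<open>
  By Bezout, the multiples of \<open>c\<close> are modulo \<open>n\<close> the multiples of \<open>gcd c n\<close>.
\<close>

lemma cong_gcd_iff:
  fixes i j c n :: int
  shows "(\<exists>u. [i = j + c * u] (mod n)) \<longleftrightarrow> [i = j] (mod gcd c n)"
proof
  assume "\<exists>u. [i = j + c * u] (mod n)"
  then obtain u where "[i = j + c * u] (mod gcd c n)"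
    using cong_dvd_modulus gcd_dvd2 by blast
  moreover have "[j + c * u = j + 0] (mod gcd c n)"
    by (intro cong_add cong_refl) (simp add: cong_0_iff)
  ultimately show "[i = j] (mod gcd c n)" using cong_trans by fastforce
next
  assume "[i = j] (mod gcd c n)"
  then obtain w where w: "i - j = gcd c n * w" by (auto simp: cong_iff_dvd_diff)
  obtain x y where xy: "x * c + y * n = gcd c n" using bezout_int by blast
  have "i - (j + c * (x * w)) = n * (y * w)"
    using w unfolding xy[symmetric] by (simp add: algebra_simps)
  then show "\<exists>u. [i = j + c * u] (mod n)"
    by (metis cong_iff_dvd_diff dvd_triv_left)
qed

lemma (in group) equiv_twisted_conj:
  assumes "\<phi> \<in> hom G G"
  shows "equiv (carrier G) (twisted_conj G \<phi>)"
proof (rule equivI)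
  interpret \<phi>: group_hom G G \<phi>
    using assms by (simp add: group_hom_def group_hom_axioms_def group_axioms)
  show "twisted_conj G \<phi> \<subseteq> carrier G \<times> carrier G" by (auto simp: twisted_conj_def)
  show "refl_on (carrier G) (twisted_conj G \<phi>)"
    by (rule refl_onI) (auto simp: twisted_conj_def intro!: bexI[of _ \<one>])
  show "sym (twisted_conj G \<phi>)"
  proof (rule symI)
    fix x y assume "(x, y) \<in> twisted_conj G \<phi>"
    then obtain g where g: "g \<in> carrier G" "x \<in> carrier G" "y \<in> carrier G"
      "x = g \<otimes> y \<otimes> inv (\<phi> g)" by (auto simp: twisted_conj_def)
    have "inv g \<otimes> (g \<otimes> y) = y" using g(1,3) by (simp flip: m_assoc)
    then have "y = inv g \<otimes> x \<otimes> inv (\<phi> (inv g))"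
      using g(1,3) unfolding g(4) by (simp add: m_assoc)
    then show "(y, x) \<in> twisted_conj G \<phi>"
      unfolding twisted_conj_def using g(1-3) inv_closed by blast
  qed
  show "trans (twisted_conj G \<phi>)"
  proof (rule transI)
    fix x y z assume "(x, y) \<in> twisted_conj G \<phi>" "(y, z) \<in> twisted_conj G \<phi>"
    then obtain g h where gh: "g \<in> carrier G" "h \<in> carrier G" "x \<in> carrier G" "z \<in> carrier G"
      "x = g \<otimes> y \<otimes> inv (\<phi> g)" "y = h \<otimes> z \<otimes> inv (\<phi> h)" by (auto simp: twisted_conj_def)
    have "x = (g \<otimes> h) \<otimes> z \<otimes> inv (\<phi> (g \<otimes> h))"
      using gh(1,2,4) unfolding gh(5,6) by (simp add: m_assoc inv_mult_group)
    then show "(x, z) \<in> twisted_conj G \<phi>"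
      unfolding twisted_conj_def using gh(1-4) m_closed by blast
  qed
qed

text \<open>
  The group is given by its multiplication table on the exponents, with \<open>p i\<close> for \<open>x\<^sup>i\<close> and \<open>q i\<close> for
  \<open>x\<^sup>i y\<close>; the exponents count modulo \<open>2 * M\<close>, so that all computations below take place in \<open>int\<close>.
  The condition \<open>four_dvd\<close> makes \<open>a - 1\<close> twice an odd number.
\<close>

locale cyclic_by_involution = group G for G (structure) +
  fixes M s a :: int and p q :: "int \<Rightarrow> 'a"
  assumes M_pos: "M > 0" and M_even: "even M" and four_dvd: "4 dvd s * M" and a_def: "a = s * M - 1"
    and p_eq_iff: "p i = p j \<longleftrightarrow> [i = j] (mod 2 * M)"
    and q_eq_iff: "q i = q j \<longleftrightarrow> [i = j] (mod 2 * M)"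
    and p_neq_q: "p i \<noteq> q j"
    and carrier_eq: "carrier G = range p \<union> range q"
    and p_p: "p i \<otimes> p j = p (i + j)" and p_q: "p i \<otimes> q j = q (i + j)"
    and q_p: "q i \<otimes> p j = q (i + a * j)" and q_q: "q i \<otimes> q j = p (i + a * j)"
begin

lemmas mult_table = p_p p_q q_p q_q

lemma p_closed [simp]: "p i \<in> carrier G" and q_closed [simp]: "q i \<in> carrier G"
  by (auto simp: carrier_eq)

lemma one_eq: "\<one> = p 0"
  using p_p[of 0 0] by (simp add: l_cancel_one')

lemma inv_p: "inv (p i) = p (- i)" and inv_q: "inv (q i) = q (- (a * i))"
  by (rule inv_equality; simp add: mult_table one_eq)+

lemma odd_a: "odd a" using M_even by (simp add: a_def)

lemma a_square: "[a * a = 1] (mod 2 * M)"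
proof -
  obtain w where w: "M = 2 * w" using M_even by blast
  have "a * a - 1 = 2 * M * (s * (s * w - 1))"
    unfolding a_def w by (simp add: algebra_simps)
  then show ?thesis by (simp add: cong_iff_dvd_diff)
qed

text \<open>
  A common divisor of \<open>a - 1 = s M - 2\<close> and \<open>2 M\<close> divides \<open>2 (s M) - 2 (s M - 2) = 4\<close>, hence \<open>s M\<close>, hence 2.
\<close>

lemma gcd_a_minus_1:
  assumes "even g" and "g dvd 2 * M"
  shows "gcd (a - 1) g = 2"
proof -
  define d where "d = gcd (a - 1) g"
  have "d dvd s * M - 2" unfolding d_def a_def by (metis diff_diff_eq gcd_dvd1 one_add_one)
  have "d dvd 2 * M" unfolding d_def using assms(2) dvd_trans gcd_dvd2 by blast
  have "d dvd s * (2 * M) - 2 * (s * M - 2)"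
    by (rule dvd_diff; rule dvd_mult; fact)
  then have "d dvd 4" by (simp add: algebra_simps)
  then have "d dvd s * M" using four_dvd dvd_trans by blast
  from dvd_diff[OF this \<open>d dvd s * M - 2\<close>] have "d dvd 2" by simp
  moreover have "2 dvd d" unfolding d_def using assms(1) odd_a by simp
  moreover have "d \<ge> 0" by (simp add: d_def)
  ultimately show ?thesis unfolding d_def[symmetric] by (intro zdvd_antisym_nonneg) auto
qed

text \<open>
  The subgroup of the \<open>p i\<close> is preserved: the square of \<open>q j\<close> is \<open>p (s * M * j)\<close>, whose square is
  trivial, so if \<open>p 1\<close> were mapped to \<open>q j\<close>, its order \<open>2 * M\<close> would divide 4. That leaves \<open>M = 2\<close>; then
  \<open>s\<close> is even, already the square of \<open>q j\<close> is trivial, and the order would divide 2. The congruence for \<open>l\<close> is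
  the image of the relation \<open>q 0 \<otimes> q 0 = \<one>\<close>.
\<close>

lemma automorphism_parameters:
  assumes "\<phi> \<in> auto G"
  obtains k l where "coprime k (2 * M)" "[s * M * l = 0] (mod 2 * M)"
    "\<And>i. \<phi> (p i) = p (k * i)" "\<And>i. \<phi> (q i) = q (k * i + l)"
proof -
  have hom: "\<phi> \<in> hom G G" and bij: "bij_betw \<phi> (carrier G) (carrier G)"
    using assms by (auto simp: auto_def Bij_def)
  then interpret \<phi>: group_hom G G \<phi>
    by (simp add: group_hom_def group_hom_axioms_def group_axioms)
  have inj: "\<phi> z = \<phi> z' \<longleftrightarrow> z = z'" if "z \<in> carrier G" "z' \<in> carrier G" for z z'
    using bij that by (meson bij_betw_imp_inj_on inj_on_eq_iff)
  have onto: "\<exists>z \<in> carrier G. \<phi> z = z'" if "z' \<in> carrier G" for z'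
    using bij that by (metis bij_betw_imp_surj_on imageE)
  have one: "\<phi> (p 0) = p 0" using \<phi>.hom_one by (simp add: one_eq)
  have "\<exists>k. \<phi> (p 1) = p k"
  proof (rule ccontr)
    assume "\<nexists>k. \<phi> (p 1) = p k"
    then obtain j where j: "\<phi> (p 1) = q j"
      using \<phi>.hom_closed[of "p 1"] by (auto simp: carrier_eq)
    have p2: "\<phi> (p 2) = p (s * M * j)"
      using \<phi>.hom_mult[of "p 1" "p 1"] by (simp add: mult_table j a_def algebra_simps)
    have "\<phi> (p 4) = p (2 * M * (s * j))"
      using \<phi>.hom_mult[of "p 2" "p 2"] by (simp add: mult_table p2 algebra_simps)
    also have "\<dots> = \<phi> (p 0)" unfolding one p_eq_iff by (simp add: cong_0_iff)
    finally have "2 * M dvd 2 * 2" by (simp add: inj p_eq_iff cong_0_iff)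
    then obtain w where "2 * 2 = 2 * M * w" by (rule dvdE)
    then have "2 = M * w" by simp
    then have "M dvd 2" by (rule dvdI)
    then have "M = 2" using M_pos M_even by (auto dest: zdvd_imp_le)
    then have "even s" using four_dvd by presburger
    then have "p (s * M * j) = p 0" unfolding p_eq_iff by (auto simp: cong_0_iff)
    then have "\<phi> (p 2) = \<phi> (p 0)" using p2 one by simp
    then have "2 * M dvd 2" by (simp add: inj p_eq_iff cong_0_iff)
    then show False using \<open>M = 2\<close> by simp
  qed
  then obtain k where k: "\<phi> (p 1) = p k" by blast
  have pm1: "\<phi> (p (- 1)) = p (- k)"
    using \<phi>.hom_inv[of "p 1"] by (simp add: inv_p k)
  have P: "\<phi> (p i) = p (k * i)" for i
  proof (induction i rule: int_induct[of _ 0])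
    case base
    show ?case by (simp add: one)
  next
    case (step1 i)
    then show ?case using \<phi>.hom_mult[of "p i" "p 1"] by (simp add: p_p k algebra_simps)
  next
    case (step2 i)
    then show ?case using \<phi>.hom_mult[of "p i" "p (- 1)"] by (simp add: p_p pm1 algebra_simps)
  qed
  have "\<exists>l. \<phi> (q 0) = q l"
  proof (rule ccontr)
    assume "\<nexists>l. \<phi> (q 0) = q l"
    then obtain j where j: "\<phi> (q 0) = p j"
      using \<phi>.hom_closed[of "q 0"] by (auto simp: carrier_eq)
    have "\<phi> (q i) = p (k * i + j)" for i
      using \<phi>.hom_mult[of "p i" "q 0"] by (simp add: mult_table P j)
    then show False using onto[of "q 0"] P p_neq_q by (auto simp: carrier_eq)
  qed
  then obtain l where l: "\<phi> (q 0) = q l" by blast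
  have Q: "\<phi> (q i) = q (k * i + l)" for i
    using \<phi>.hom_mult[of "p i" "q 0"] by (simp add: mult_table P l)
  obtain i where "p (k * i) = p 1"
    using onto[of "p 1"] P Q p_neq_q by (auto simp: carrier_eq) metis
  then have "coprime k (2 * M)" unfolding p_eq_iff coprime_iff_invertible_int by blast
  moreover have "[s * M * l = 0] (mod 2 * M)"
    using \<phi>.hom_mult[of "q 0" "q 0"] by (simp add: mult_table l one p_eq_iff a_def algebra_simps cong_sym_eq)
  ultimately show thesis using that P Q by blast
qed

lemma automorphism_exists:
  assumes cop: "coprime k (2 * M)" and l: "[s * M * l = 0] (mod 2 * M)"
  obtains \<phi> where "\<phi> \<in> auto G" "\<And>i. \<phi> (p i) = p (k * i)" "\<And>i. \<phi> (q i) = q (k * i + l)"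
proof -
  define \<phi> where "\<phi> = (\<lambda>z \<in> carrier G. if z \<in> range p then p (k * inv_into UNIV p z)
    else q (k * inv_into UNIV q z + l))"
  have P: "\<phi> (p i) = p (k * i)" for i
  proof -
    have "p (inv_into UNIV p (p i)) = p i" by (rule f_inv_into_f) simp
    moreover have "p i \<in> range p" by (rule rangeI)
    ultimately show ?thesis by (simp only: \<phi>_def restrict_apply p_closed if_True p_eq_iff cong_scalar_left)
  qed
  have Q: "\<phi> (q i) = q (k * i + l)" for i
  proof -
    have "q (inv_into UNIV q (q i)) = q i" by (rule f_inv_into_f) simp
    moreover have "q i \<notin> range p" using p_neq_q by (metis imageE)
    ultimately show ?thesis by (simp add: \<phi>_def q_eq_iff cong_scalar_left cong_add_rcancel)
  qed
  \<comment> \<open>By the condition on \<open>l\<close>, the product of the images of two elements \<open>q i\<close> has the right exponent.\<close>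
  have twist: "p (x + s * M * l) = p x" for x
    unfolding p_eq_iff using cong_add[OF cong_refl l] by simp
  have "\<phi> \<in> hom G G"
  proof (rule homI)
    show "\<phi> z \<in> carrier G" if "z \<in> carrier G" for z
      using that P Q by (auto simp: carrier_eq)
    have qq: "p (k * i + l + a * (k * j + l)) = p (k * (i + a * j))" for i j
      using twist[of "k * (i + a * j)"] by (simp add: a_def algebra_simps)
    show "\<phi> (z \<otimes> z') = \<phi> z \<otimes> \<phi> z'" if "z \<in> carrier G" "z' \<in> carrier G" for z z'
      using that unfolding carrier_eq
      by (elim UnE rangeE; simp add: mult_table P Q qq) (simp_all add: algebra_simps)
  qed
  moreover have "bij_betw \<phi> (carrier G) (carrier G)"
  proof (rule bij_betw_imageI)
    have inj: "[k * i = k * j] (mod 2 * M) \<longleftrightarrow> [i = j] (mod 2 * M)" for i j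
      by (rule cong_mult_lcancel[OF cop])
    show "inj_on \<phi> (carrier G)"
    proof (rule inj_onI)
      fix z z' assume "z \<in> carrier G" "z' \<in> carrier G" "\<phi> z = \<phi> z'"
      then show "z = z'" unfolding carrier_eq
        using p_neq_q p_neq_q[symmetric]
        by (elim UnE rangeE; simp add: P Q p_eq_iff q_eq_iff cong_add_rcancel inj)
    qed
    obtain k' where k': "[k * k' = 1] (mod 2 * M)"
      using cop by (auto simp: coprime_iff_invertible_int)
    have kk': "[k * (k' * i) = i] (mod 2 * M)" for i
      using cong_scalar_right[OF k', of i] by (simp add: mult.assoc)
    show "\<phi> ` carrier G = carrier G"
    proof (intro equalityI subsetI)
      fix z assume "z \<in> \<phi> ` carrier G"
      then show "z \<in> carrier G" using P Q by (auto simp: carrier_eq)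
    next
      fix z assume "z \<in> carrier G"
      then consider i where "z = p i" | i where "z = q i" by (auto simp: carrier_eq)
      then show "z \<in> \<phi> ` carrier G"
      proof cases
        case (1 i)
        then have "z = \<phi> (p (k' * i))" using kk'[of i] by (simp add: P p_eq_iff cong_sym_eq)
        then show ?thesis by simp
      next
        case (2 i)
        have "[k * (k' * (i - l)) + l = i - l + l] (mod 2 * M)"
          by (rule cong_add[OF kk' cong_refl])
        then have "z = \<phi> (q (k' * (i - l)))" using 2 by (simp add: Q q_eq_iff cong_sym_eq)
        then show ?thesis by simp
      qed
    qed
  qed
  moreover have "\<phi> \<in> extensional (carrier G)" by (simp add: \<phi>_def)
  ultimately have "\<phi> \<in> auto G" by (simp add: auto_def Bij_def)
  then show thesis using that P Q by blast
qed

text \<open>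
  Conjugating with \<open>p u\<close> shifts exponents by multiples of \<open>1 - k\<close> on the \<open>p i\<close> and of \<open>1 - a * k\<close> on the
  \<open>q i\<close>; conjugating with \<open>q u\<close> adds the involutions \<open>i \<mapsto> a * i - l\<close> and \<open>i \<mapsto> a * i - a * l\<close>. Both
  constant terms have the parity of \<open>l\<close> because \<open>a\<close> is odd.
\<close>

lemma Reidemeister_number_automorphism:
  assumes "\<phi> \<in> auto G" and l: "[s * M * l = 0] (mod 2 * M)"
    and P: "\<And>i. \<phi> (p i) = p (k * i)" and Q: "\<And>i. \<phi> (q i) = q (k * i + l)"
    and h0: "gcd (1 - k) (2 * M) = 2 * int h0" and h1: "gcd (1 - a * k) (2 * M) = 2 * int h1"
  shows "Reidemeister_number G \<phi> = enat (h0 + h1 + (if even l then 2 else 0))"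
proof -
  define T where "T = twisted_conj G \<phi>"
  have equiv: "equiv (carrier G) T"
    unfolding T_def using assms(1) by (intro equiv_twisted_conj) (simp add: auto_def)
  have T_iff: "(z, z') \<in> T \<longleftrightarrow>
      (\<exists>u. z = p u \<otimes> z' \<otimes> p (- (k * u))) \<or> (\<exists>u. z = q u \<otimes> z' \<otimes> q (- (a * (k * u + l))))"
    if "z \<in> carrier G" "z' \<in> carrier G" for z z'
  proof -
    have "(z, z') \<in> T \<longleftrightarrow> (\<exists>g \<in> range p \<union> range q. z = g \<otimes> z' \<otimes> inv (\<phi> g))"
      using that by (simp add: T_def twisted_conj_def flip: carrier_eq)
    then show ?thesis by (simp add: bex_Un P Q inv_p inv_q)
  qed
  have pp: "(p i, p j) \<in> T \<longleftrightarrow> [i = j] (mod 2 * int h0) \<or> [i = a * j + - l] (mod 2 * int h0)" for i j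
  proof -
    have 1: "p u \<otimes> p j \<otimes> p (- (k * u)) = p (j + (1 - k) * u)" for u
      by (simp add: mult_table algebra_simps)
    have 2: "q u \<otimes> p j \<otimes> q (- (a * (k * u + l))) = p (a * j + - l + (1 - k) * u)" for u
    proof -
      have "[u + a * j - a * a * (k * u + l) = u + a * j - 1 * (k * u + l)] (mod 2 * M)"
        by (intro cong_diff cong_refl cong_scalar_right a_square)
      then show ?thesis by (simp add: mult_table p_eq_iff algebra_simps)
    qed
    show ?thesis
      unfolding T_iff[OF p_closed p_closed] 1 2 p_eq_iff cong_gcd_iff h0 ..
  qed
  have qq: "(q i, q j) \<in> T \<longleftrightarrow> [i = j] (mod 2 * int h1) \<or> [i = a * j + - (a * l)] (mod 2 * int h1)" for i j
  proof -
    have 1: "p u \<otimes> q j \<otimes> p (- (k * u)) = q (j + (1 - a * k) * u)" for u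
      by (simp add: mult_table algebra_simps)
    have 2: "q u \<otimes> q j \<otimes> q (- (a * (k * u + l))) = q (a * j + - (a * l) + (1 - a * k) * u)" for u
      by (simp add: mult_table algebra_simps)
    show ?thesis
      unfolding T_iff[OF q_closed q_closed] 1 2 q_eq_iff cong_gcd_iff h1 ..
  qed
  have pq: "(p i, q j) \<notin> T" for i j
    using p_neq_q by (simp add: T_iff mult_table)
  define Fp where "Fp = (\<lambda>i. T `` {p i})"
  define Fq where "Fq = (\<lambda>i. T `` {q i})"
  have Fp: "Fp i = Fp j \<longleftrightarrow> [i = j] (mod 2 * int h0) \<or> [i = a * j + - l] (mod 2 * int h0)" for i j
    unfolding Fp_def pp[symmetric] by (rule eq_equiv_class_iff[OF equiv]) auto
  have Fq: "Fq i = Fq j \<longleftrightarrow> [i = j] (mod 2 * int h1) \<or> [i = a * j + - (a * l)] (mod 2 * int h1)" for i j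
    unfolding Fq_def qq[symmetric] by (rule eq_equiv_class_iff[OF equiv]) auto
  have disj: "range Fp \<inter> range Fq = {}"
    unfolding Fp_def Fq_def using pq eq_equiv_class_iff[OF equiv p_closed q_closed] by blast
  have quotient: "carrier G // T = range Fp \<union> range Fq"
    by (auto simp: quotient_def carrier_eq Fp_def Fq_def)
  have dvd: "2 * int h0 dvd 2 * M" "2 * int h1 dvd 2 * M"
    unfolding h0[symmetric] h1[symmetric] by simp_all
  have pos: "h0 > 0" "h1 > 0" using dvd M_pos by (auto intro: gr0I)
  have fix_l: "[(a + 1) * - l = 0] (mod 2 * M)"
    using cong_uminus[OF l] by (simp add: a_def)
  have fix_al: "[(a + 1) * - (a * l) = 0] (mod 2 * M)"
    using cong_scalar_left[OF fix_l, of a] by (simp add: algebra_simps)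
  note Cp = card_affine_involution_classes[OF pos(1) gcd_a_minus_1[OF _ dvd(1)]
      cong_dvd_modulus[OF a_square dvd(1)] cong_dvd_modulus[OF fix_l dvd(1)] Fp, simplified]
  note Cq = card_affine_involution_classes[OF pos(2) gcd_a_minus_1[OF _ dvd(2)]
      cong_dvd_modulus[OF a_square dvd(2)] cong_dvd_modulus[OF fix_al dvd(2)] Fq, simplified]
  have "card (carrier G // T) = card (range Fp) + card (range Fq)"
    unfolding quotient using Cp(1) Cq(1) disj by (rule card_Un_disjoint)
  also have "\<dots> = h0 + h1 + (if even l then 2 else 0)"
    using Cp(2) Cq(2) odd_a by simp
  finally have "card (carrier G // T) = h0 + h1 + (if even l then 2 else 0)" .
  moreover have "finite (carrier G // T)" unfolding quotient using Cp(1) Cq(1) by simp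
  ultimately show ?thesis by (simp add: Reidemeister_number_def T_def)
qed

text \<open>
  The summand \<open>r = 0\<close> comes from odd \<open>l\<close>, and an odd \<open>l\<close> defines an automorphism only for even \<open>s\<close>.
\<close>

theorem reidemeister_spectrum:
  fixes n m :: nat
  assumes n: "odd n" and m: "m \<ge> 2" and M: "M = 2 ^ (m - 1) * int n"
  shows "Spec\<^sub>R G = enat ` {2 ^ e * d0 + d1 + r | e d0 d1 r.
    1 \<le> e \<and> e \<le> m - 1 \<and> (d0, d1) \<in> admissible_pairs n \<and> (r = 2 \<or> r = 0 \<and> even s)}"
    (is "_ = enat ` ?S")
proof -
  have N: "2 * M = 2 ^ m * int n" using m by (cases m) (auto simp: M)
  note a = a_def[unfolded M] and four = four_dvd[unfolded M]
  have l_iff: "[s * M * l = 0] (mod 2 * M) \<longleftrightarrow> even (s * l)" for l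
  proof -
    have "[s * M * l = 0] (mod 2 * M) \<longleftrightarrow> M * 2 dvd M * (s * l)"
      by (simp add: cong_0_iff mult.commute mult.left_commute)
    then show ?thesis using M_pos by (simp only: dvd_mult_cancel_left) simp
  qed
  show ?thesis
  proof (intro equalityI subsetI)
    fix R assume "R \<in> Spec\<^sub>R G"
    then obtain \<phi> where \<phi>: "\<phi> \<in> auto G" "R = Reidemeister_number G \<phi>"
      by (auto simp: Spec\<^sub>R_def)
    obtain k l where kl: "coprime k (2 * M)" "[s * M * l = 0] (mod 2 * M)"
      "\<And>i. \<phi> (p i) = p (k * i)" "\<And>i. \<phi> (q i) = q (k * i + l)"
      using automorphism_parameters[OF \<phi>(1)] by blast
    obtain e d0 d1 h0 h1 where h: "1 \<le> e" "e \<le> m - 1" "(d0, d1) \<in> admissible_pairs n"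
      "gcd (1 - k) (2 ^ m * int n) = 2 * int h0" "gcd (1 - a * k) (2 ^ m * int n) = 2 * int h1"
      "h0 + h1 = 2 ^ e * d0 + d1"
      using half_gcds_shape[OF n m a four, of k] kl(1) unfolding N by blast
    define r :: nat where "r = (if even l then 2 else 0)"
    have "R = enat (2 ^ e * d0 + d1 + r)"
      using Reidemeister_number_automorphism[OF \<phi>(1) kl(2-4), of h0 h1] h(4-6) \<phi>(2)
      unfolding N r_def by simp
    moreover have "r = 2 \<or> r = 0 \<and> even s" using kl(2) unfolding l_iff r_def by auto
    ultimately show "R \<in> enat ` ?S" using h(1-3) by blast
  next
    fix R assume "R \<in> enat ` ?S"
    then obtain e d0 d1 r where R: "R = enat (2 ^ e * d0 + d1 + r)" and e: "1 \<le> e" "e \<le> m - 1"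
      and E: "(d0, d1) \<in> admissible_pairs n" and r: "r = 2 \<or> r = 0 \<and> even s" by blast
    obtain k where k: "coprime k (2 ^ m * int n)" "gcd (1 - k) (2 ^ m * int n) = 2 * int (2 ^ e * d0)"
      "gcd (1 - a * k) (2 ^ m * int n) = 2 * int d1"
      using half_gcds_realised[OF n m a four e E] by blast
    \<comment> \<open>Only the parity of \<open>l\<close> enters the Reidemeister number.\<close>
    define l :: int where "l = (if r = 2 then 0 else 1)"
    have l: "[s * M * l = 0] (mod 2 * M)" unfolding l_iff l_def using r by auto
    obtain \<phi> where \<phi>: "\<phi> \<in> auto G" "\<And>i. \<phi> (p i) = p (k * i)" "\<And>i. \<phi> (q i) = q (k * i + l)"
      using automorphism_exists[OF _ l, of k] k(1) unfolding N by blast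
    have "Reidemeister_number G \<phi> = enat (2 ^ e * d0 + d1 + (if even l then 2 else 0))"
      using Reidemeister_number_automorphism[OF \<phi>(1) l \<phi>(2,3)] k(2,3) unfolding N by blast
    moreover have "(if even l then 2 else 0) = r" using r by (auto simp: l_def)
    ultimately have "R = Reidemeister_number G \<phi>" using R by simp
    then show "R \<in> Spec\<^sub>R G" unfolding Spec\<^sub>R_def using \<phi>(1) by blast
  qed
qed

end

section \<open>The groups as semidirect products\<close>

lemma AutoGroup_action:
  assumes "group K" and "group H" and \<alpha>: "\<alpha> \<in> hom K (AutoGroup H)"
  shows action_hom: "k \<in> carrier K \<Longrightarrow> \<alpha> k \<in> hom H H"
    and action_mult: "k \<in> carrier K \<Longrightarrow> k' \<in> carrier K \<Longrightarrow> h \<in> carrier H \<Longrightarrow>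
      \<alpha> (k \<otimes>\<^bsub>K\<^esub> k') h = \<alpha> k (\<alpha> k' h)"
    and action_one: "h \<in> carrier H \<Longrightarrow> \<alpha> \<one>\<^bsub>K\<^esub> h = h"
proof -
  interpret H: group H by fact
  have auto: "\<alpha> k \<in> auto H" if "k \<in> carrier K" for k
    using hom_in_carrier[OF \<alpha> that] by (simp add: AutoGroup_def)
  then show "\<alpha> k \<in> hom H H" if "k \<in> carrier K"
    using that by (simp add: auto_def)
  show "\<alpha> (k \<otimes>\<^bsub>K\<^esub> k') h = \<alpha> k (\<alpha> k' h)"
    if "k \<in> carrier K" "k' \<in> carrier K" "h \<in> carrier H"
    using hom_mult[OF \<alpha> that(1,2)] auto[OF that(1)] auto[OF that(2)] that(3)
    by (simp add: AutoGroup_def BijGroup_def auto_def compose_eq)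
  have "\<alpha> \<one>\<^bsub>K\<^esub> = \<one>\<^bsub>AutoGroup H\<^esub>"
    by (rule hom_one[OF \<alpha> \<open>group K\<close> H.AutoGroup])
  then show "\<alpha> \<one>\<^bsub>K\<^esub> h = h" if "h \<in> carrier H"
    using that by (simp add: AutoGroup_def BijGroup_def)
qed

lemma group_semidirect:
  assumes "group K" and "group H" and "\<alpha> \<in> hom K (AutoGroup H)"
  shows "group (semidirect H K \<alpha>)"
proof -
  interpret K: group K by fact
  interpret H: group H by fact
  note act = action_hom[OF assms] action_mult[OF assms] action_one[OF assms]
  have closed: "\<alpha> k h \<in> carrier H" if "k \<in> carrier K" "h \<in> carrier H" for k h
    using hom_in_carrier[OF act(1)] that by blast
  have mult: "\<alpha> k (h \<otimes>\<^bsub>H\<^esub> h') = \<alpha> k h \<otimes>\<^bsub>H\<^esub> \<alpha> k h'"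
    if "k \<in> carrier K" "h \<in> carrier H" "h' \<in> carrier H" for k h h'
    using hom_mult[OF act(1)] that by blast
  show ?thesis
  proof (rule groupI)
    fix z assume "z \<in> carrier (semidirect H K \<alpha>)"
    then obtain h k where z: "z = (h, k)" "h \<in> carrier H" "k \<in> carrier K"
      by (auto simp: semidirect_def)
    have "(\<alpha> (inv\<^bsub>K\<^esub> k) (inv\<^bsub>H\<^esub> h), inv\<^bsub>K\<^esub> k) \<otimes>\<^bsub>semidirect H K \<alpha>\<^esub> z = \<one>\<^bsub>semidirect H K \<alpha>\<^esub>"
      using z mult[of "inv\<^bsub>K\<^esub> k" "inv\<^bsub>H\<^esub> h" h] hom_one[OF act(1) H.group_axioms H.group_axioms, of "inv\<^bsub>K\<^esub> k"]
      by (simp add: semidirect_def)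
    then show "\<exists>w \<in> carrier (semidirect H K \<alpha>). w \<otimes>\<^bsub>semidirect H K \<alpha>\<^esub> z = \<one>\<^bsub>semidirect H K \<alpha>\<^esub>"
      using z closed by (intro bexI[of _ "(\<alpha> (inv\<^bsub>K\<^esub> k) (inv\<^bsub>H\<^esub> h), inv\<^bsub>K\<^esub> k)"]) (auto simp: semidirect_def)
  qed (auto simp: semidirect_def closed mult act(2,3) H.m_assoc K.m_assoc)
qed

lemma cyclic_by_involution_semidirect:
  fixes H :: "('a, 'b) monoid_scheme" and M s a :: int
  assumes "group H" and x: "generator H x" and card: "int (card (carrier H)) = 2 * M"
    and \<alpha>: "\<alpha> \<in> hom (C 2) (AutoGroup H)" and \<alpha>x: "\<alpha> 1 x = x [^]\<^bsub>H\<^esub> a"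
    and M: "M > 0" "even M" "4 dvd s * M" "a = s * M - 1"
  shows "cyclic_by_involution (semidirect H (C 2) \<alpha>) M s a
    (\<lambda>i. (x [^]\<^bsub>H\<^esub> i, 0)) (\<lambda>i. (x [^]\<^bsub>H\<^esub> i, 1))"
proof -
  interpret H: group H by fact
  interpret G: group "semidirect H (C 2) \<alpha>"
    by (rule group_semidirect[OF group_integer_mod_group assms(1) \<alpha>])
  note act = action_hom[OF group_integer_mod_group assms(1) \<alpha>]
    action_one[OF group_integer_mod_group assms(1) \<alpha>]
  have xc: "x \<in> carrier H" and gen: "generate H {x} = carrier H"
    using x by (auto simp: generator_def)
  have "int (H.ord x) = 2 * M" using H.generate_pow_card[OF xc] gen card by simp
  then have pow_eq: "x [^]\<^bsub>H\<^esub> i = x [^]\<^bsub>H\<^esub> j \<longleftrightarrow> [i = j] (mod 2 * M)" for i j :: int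
    using H.int_pow_eq[OF xc, of i j] by (simp add: cong_iff_dvd_diff dvd_diff_commute)
  have range: "carrier H = range (\<lambda>i::int. x [^]\<^bsub>H\<^esub> i)"
    using H.generate_pow[OF xc] gen by auto
  have \<alpha>0: "\<alpha> 0 h = h" if "h \<in> carrier H" for h using act(2)[OF that] by simp
  have \<alpha>1: "\<alpha> 1 (x [^]\<^bsub>H\<^esub> i) = x [^]\<^bsub>H\<^esub> (a * i)" for i :: int
  proof -
    have "\<alpha> 1 (x [^]\<^bsub>H\<^esub> i) = \<alpha> 1 x [^]\<^bsub>H\<^esub> i"
      by (rule hom_int_pow[OF act(1) xc assms(1) assms(1)]) simp
    then show ?thesis by (simp add: \<alpha>x H.int_pow_pow xc)
  qed
  have C2: "carrier (C 2) = {0, 1}" by (auto simp: carrier_integer_mod_group)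
  show ?thesis
  proof (intro cyclic_by_involution.intro cyclic_by_involution_axioms.intro)
    show "group (semidirect H (C 2) \<alpha>)" by (rule G.group_axioms)
    show "carrier (semidirect H (C 2) \<alpha>) =
        range (\<lambda>i::int. (x [^]\<^bsub>H\<^esub> i, 0)) \<union> range (\<lambda>i::int. (x [^]\<^bsub>H\<^esub> i, 1))"
      by (auto simp: semidirect_def C2 range)
  qed (simp_all add: M pow_eq semidirect_def \<alpha>0 \<alpha>1 xc H.int_pow_mult)
qed

text \<open>
  The conjugation is by the inverse of \<open>(1, y)\<close>, but \<open>y\<close> has order 2, so that this inverse acts as \<open>\<alpha> 1\<close> too.
\<close>

lemma generator_action_eq:
  fixes a :: int
  assumes "group H" and "x \<in> carrier H" and \<alpha>: "\<alpha> \<in> hom (C 2) (AutoGroup H)"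
    and a: "inv\<^bsub>semidirect H (C 2) \<alpha>\<^esub> (\<one>\<^bsub>H\<^esub>, 1) \<otimes>\<^bsub>semidirect H (C 2) \<alpha>\<^esub> (x, \<one>\<^bsub>C 2\<^esub>)
        \<otimes>\<^bsub>semidirect H (C 2) \<alpha>\<^esub> (\<one>\<^bsub>H\<^esub>, 1) = (x, \<one>\<^bsub>C 2\<^esub>) [^]\<^bsub>semidirect H (C 2) \<alpha>\<^esub> a"
  shows "\<alpha> 1 x = x [^]\<^bsub>H\<^esub> a"
proof -
  let ?G = "semidirect H (C 2) \<alpha>"
  interpret H: group H by fact
  interpret G: group ?G
    by (rule group_semidirect[OF group_integer_mod_group assms(1) \<alpha>])
  note act = action_hom[OF group_integer_mod_group assms(1) \<alpha>]
    action_mult[OF group_integer_mod_group assms(1) \<alpha>]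
    action_one[OF group_integer_mod_group assms(1) \<alpha>]
  have C2: "carrier (C 2) = {0, 1}" by (auto simp: carrier_integer_mod_group)
  have \<alpha>0: "\<alpha> 0 h = h" if "h \<in> carrier H" for h using act(3)[OF that] by simp
  have \<alpha>11: "\<alpha> 1 (\<alpha> 1 h) = h" if "h \<in> carrier H" for h
    using act(2)[of 1 1 h] that \<alpha>0 by (simp add: C2)
  have closed: "\<alpha> 1 h \<in> carrier H" if "h \<in> carrier H" for h
    using hom_in_carrier[OF act(1) that, of 1] by (simp add: C2)
  have one: "\<alpha> 1 \<one>\<^bsub>H\<^esub> = \<one>\<^bsub>H\<^esub>"
    using hom_one[OF act(1) assms(1) assms(1), of 1] by (simp add: C2)
  have "(\<lambda>h. (h, 0)) \<in> hom H ?G"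
    by (rule homI) (auto simp: semidirect_def \<alpha>0 C2)
  from hom_int_pow[OF this assms(2) assms(1) G.group_axioms]
  have pow: "(x, 0) [^]\<^bsub>?G\<^esub> a = (x [^]\<^bsub>H\<^esub> a, 0)" by simp
  have "inv\<^bsub>?G\<^esub> (\<one>\<^bsub>H\<^esub>, 1) = (\<one>\<^bsub>H\<^esub>, 1)"
    by (rule G.inv_equality) (auto simp: semidirect_def C2 one)
  then have "(\<alpha> 1 x, 0) = (x [^]\<^bsub>H\<^esub> a, (0::int))"
    using a assms(2) closed by (simp add: pow) (simp add: semidirect_def one)
  then show ?thesis by simp
qed

lemma generator_C2:
  assumes "generator (C 2) y"
  shows "y = 1"
proof -
  have "y \<in> {0, 1}" using assms by (auto simp: generator_def carrier_integer_mod_group)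
  moreover have "generate (C 2) {0} \<subseteq> {0}"
  proof -
    interpret group "C 2" by simp
    show ?thesis using generate_one by simp
  qed
  moreover have "(1::int) \<in> carrier (C 2) - {0}" by (simp add: carrier_integer_mod_group)
  ultimately show ?thesis using assms unfolding generator_def by blast
qed

text \<open>
  Only \<open>m = 2\<close> needs an argument: there \<open>\<alpha> 1\<close> is multiplication by \<open>a\<close> on the integers modulo 4, so
  non-triviality says that 4 does not divide \<open>a - 1 = 2 (s n - 1)\<close>, whence \<open>s n\<close> is even.
\<close>

lemma four_dvd_if_action_nontrivial:
  fixes n m :: nat and s a :: int
  assumes n: "odd n" and m: "m \<ge> 2" and a: "a = s * (2 ^ (m - 1) * int n) - 1"
    and x: "generator (C n \<times>\<times> C (2 ^ m)) x"
    and \<alpha>: "\<alpha> \<in> hom (C 2) (AutoGroup (C n \<times>\<times> C (2 ^ m)))"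
    and \<alpha>x: "\<alpha> 1 x = x [^]\<^bsub>C n \<times>\<times> C (2 ^ m)\<^esub> a"
    and b: "b \<in> carrier (C (2 ^ m))" and k: "k \<in> carrier (C 2)" and moved: "\<alpha> k (0, b) \<noteq> (0, b)"
  shows "4 dvd s * (2 ^ (m - 1) * int n)"
proof (cases "m = 2")
  case False
  then have "(2::int) ^ 2 dvd 2 ^ (m - 1)" using m by (intro le_imp_power_dvd) simp
  then show ?thesis by simp
next
  case True
  let ?H = "C n \<times>\<times> C (2 ^ m)"
  interpret H: group ?H by (simp add: DirProd_group)
  note act = action_hom[OF group_integer_mod_group H.group_axioms \<alpha>]
    action_one[OF group_integer_mod_group H.group_axioms \<alpha>]
  have xc: "x \<in> carrier ?H" and gen: "generate ?H {x} = carrier ?H"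
    using x by (auto simp: generator_def)
  have b0: "(0, b) \<in> carrier ?H" using b by simp
  have "k = 1"
  proof -
    have "k \<in> {0, 1}" using k by (auto simp: carrier_integer_mod_group)
    then show ?thesis using moved act(2)[OF b0] by auto
  qed
  have "(0, b) \<in> generate ?H {x}" using b0 gen by simp
  then obtain j :: int where j: "(0, b) = x [^]\<^bsub>?H\<^esub> j" using H.generate_pow[OF xc] by auto
  have snd_hom: "snd \<in> hom ?H (C (2 ^ m))" by (rule homI) auto
  have "\<alpha> 1 (x [^]\<^bsub>?H\<^esub> j) = \<alpha> 1 x [^]\<^bsub>?H\<^esub> j"
    by (rule hom_int_pow[OF act(1) xc H.group_axioms H.group_axioms]) (simp add: carrier_integer_mod_group)
  also have "\<dots> = (x [^]\<^bsub>?H\<^esub> j) [^]\<^bsub>?H\<^esub> a" by (simp only: \<alpha>x H.int_pow_pow[OF xc] mult.commute)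
  finally have "\<alpha> 1 (0, b) = (0, b) [^]\<^bsub>?H\<^esub> a" by (simp add: j)
  moreover have "snd ((0, b) [^]\<^bsub>?H\<^esub> a) = (a * b) mod 4"
    using hom_int_pow[OF snd_hom b0 H.group_axioms group_integer_mod_group] True
    by (simp add: int_pow_integer_mod_group)
  moreover have "fst ((0, b) [^]\<^bsub>?H\<^esub> a) = 0"
  proof -
    have "fst \<in> hom ?H (C n)" by (rule homI) auto
    from hom_int_pow[OF this b0 H.group_axioms group_integer_mod_group]
    show ?thesis by (simp add: int_pow_integer_mod_group)
  qed
  ultimately have "(a * b) mod 4 \<noteq> b"
    using moved \<open>k = 1\<close> by (metis prod.collapse)
  moreover have "b mod 4 = b" using b True by (auto simp: carrier_integer_mod_group)
  ultimately have "\<not> 4 dvd (a - 1) * b"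
    by (metis left_diff_distrib mod_eq_dvd_iff mult_1)
  then have "\<not> 4 dvd a - 1" by auto
  then have "\<not> 4 dvd 2 * (s * int n - 1)" by (simp add: a True algebra_simps)
  moreover have "4 dvd 2 * t" if "even t" for t :: int using that by presburger
  ultimately have "odd (s * int n - 1)" by blast
  then have "even (s * int n)" by simp
  then have "2 * 2 dvd 2 * (s * int n)" by (rule mult_dvd_mono[OF dvd_refl])
  then show ?thesis using True by (simp add: ac_simps)
qed

section \<open>The Reidemeister spectrum in closed form\<close>

text \<open>
  Positivity makes \<open>2 ^ e * d0 + d1\<close> at least 2, so that the natural-number subtraction of 2 is exact and
  adding 2 or 4 to the difference amounts to adding 0 or 2 to \<open>2 ^ e * d0 + d1\<close>.
\<close>

lemma spec_dihedral_eq: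
  assumes "\<And>d0 d1. (d0, d1) \<in> E \<Longrightarrow> d0 > 0 \<and> d1 > 0"
  shows "spec_dihedral m E =
    {2 ^ e * d0 + d1 + r | e d0 d1 r. 1 \<le> e \<and> e \<le> m - 1 \<and> (d0, d1) \<in> E \<and> (r = 2 \<or> r = 0)}"
proof -
  have ge: "2 \<le> 2 ^ e * d0 + d1" if "(d0, d1) \<in> E" for e d0 d1
  proof -
    have "1 * 1 \<le> 2 ^ e * d0" using assms[OF that] by (intro mult_le_mono) auto
    then show ?thesis using assms[OF that] by linarith
  qed
  show ?thesis
  proof (intro equalityI subsetI)
    fix z assume "z \<in> spec_dihedral m E"
    then obtain c e d0 d1 where "c = 2 \<or> c = 4" and E: "1 \<le> e" "e \<le> m - 1" "(d0, d1) \<in> E"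
      and "z = c + (2 ^ e * d0 + d1 - 2)"
      unfolding spec_dihedral_def by (elim set_plus_elim) blast
    then have "z = 2 ^ e * d0 + d1 + (c - 2)" "c - 2 = 2 \<or> c - 2 = 0" using ge[OF E(3), of e] by auto
    then show "z \<in> {2 ^ e * d0 + d1 + r | e d0 d1 r.
        1 \<le> e \<and> e \<le> m - 1 \<and> (d0, d1) \<in> E \<and> (r = 2 \<or> r = 0)}" using E by blast
  next
    fix z assume "z \<in> {2 ^ e * d0 + d1 + r | e d0 d1 r.
        1 \<le> e \<and> e \<le> m - 1 \<and> (d0, d1) \<in> E \<and> (r = 2 \<or> r = 0)}"
    then obtain e d0 d1 r where r: "r = 2 \<or> r = 0" and E: "1 \<le> e" "e \<le> m - 1" "(d0, d1) \<in> E"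
      and z: "z = 2 ^ e * d0 + d1 + r" by blast
    have "z = (2 + r) + (2 ^ e * d0 + d1 - 2)" using z ge[OF E(3), of e] by simp
    moreover have "2 + r \<in> {2, 4}" using r by auto
    ultimately show "z \<in> spec_dihedral m E"
      unfolding spec_dihedral_def using E by (blast intro: set_plus_intro)
  qed
qed

theorem theorem4p2p7:
  fixes n m N :: nat and \<alpha> :: "int \<Rightarrow> int \<times> int \<Rightarrow> int \<times> int"
    and G :: "((int \<times> int) \<times> int) monoid"
    and x :: "int \<times> int" and y a :: int
  assumes "n \<ge> 1" and "odd n" and "m \<ge> 2" and "N = 2 ^ m * n"
    and "SMC_action n m 2 \<alpha>" and "G = SMC n m 2 \<alpha>"
    and "generator (C n \<times>\<times> C (2 ^ m)) x" and "generator (C 2) y"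
    and a: "inv\<^bsub>G\<^esub> (\<one>\<^bsub>C n \<times>\<times> C (2 ^ m)\<^esub>, y) \<otimes>\<^bsub>G\<^esub> (x, \<one>\<^bsub>C 2\<^esub>) \<otimes>\<^bsub>G\<^esub> (\<one>\<^bsub>C n \<times>\<times> C (2 ^ m)\<^esub>, y)
            = (x, \<one>\<^bsub>C 2\<^esub>) [^]\<^bsub>G\<^esub> a"
    and nontrivial: "\<exists>k \<in> carrier (C 2). \<exists>b \<in> carrier (C (2 ^ m)). \<alpha> k (\<one>\<^bsub>C n\<^esub>, b) \<noteq> (\<one>\<^bsub>C n\<^esub>, b)"
    and "[a = -1] (mod (2 ^ (m - 1) * int n))"
  shows "([a = -1] (mod int N) \<and> \<not> [n = 0] (mod 3) \<longrightarrow>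
            Spec\<^sub>R G = enat ` spec_dihedral m (D n)) \<and>
         ([a = 2 ^ (m - 1) * int n - 1] (mod int N) \<and> \<not> [n = 0] (mod 3) \<longrightarrow>
            m \<ge> 3 \<and> Spec\<^sub>R G = enat ` spec_semidihedral m (D n)) \<and>
         ([n = 0] (mod 3) \<longrightarrow>
            ([a = -1] (mod int N) \<longrightarrow> Spec\<^sub>R G = enat ` spec_dihedral m (D' n)) \<and>
            ([a = 2 ^ (m - 1) * int n - 1] (mod int N) \<longrightarrow>
               Spec\<^sub>R G = enat ` spec_semidihedral m (D' n)))"
proof -
  let ?H = "C n \<times>\<times> C (2 ^ m)"
  define M where "M = 2 ^ (m - 1) * int n"
  have N: "int N = 2 * M" using \<open>m \<ge> 2\<close> \<open>N = _\<close> by (cases m) (auto simp: M_def)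
  have M_pos: "M > 0" using \<open>n \<ge> 1\<close> by (simp add: M_def)
  have M_even: "even M" using \<open>m \<ge> 2\<close> by (simp add: M_def)
  obtain s where s: "a = s * M - 1"
  proof -
    obtain s where "a - - 1 = M * s"
      using \<open>[a = -1] (mod _)\<close> unfolding M_def[symmetric] cong_iff_dvd_diff by (rule dvdE)
    then show thesis using that[of s] by (simp add: algebra_simps)
  qed
  have H: "group ?H" by (simp add: DirProd_group)
  have \<alpha>: "\<alpha> \<in> hom (C 2) (AutoGroup ?H)"
    using \<open>SMC_action n m 2 \<alpha>\<close> by (simp add: SMC_action_def)
  have G: "G = semidirect ?H (C 2) \<alpha>" by (simp add: \<open>G = _\<close> SMC_def)
  have "x \<in> carrier ?H" using \<open>generator ?H x\<close> by (simp add: generator_def)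
  then have \<alpha>x: "\<alpha> 1 x = x [^]\<^bsub>?H\<^esub> a"
    using generator_action_eq[OF H _ \<alpha>] a generator_C2[OF \<open>generator (C 2) y\<close>] unfolding G by blast
  have four: "4 dvd s * M"
    using nontrivial four_dvd_if_action_nontrivial[OF \<open>odd n\<close> \<open>m \<ge> 2\<close> s[unfolded M_def] \<open>generator ?H x\<close> \<alpha> \<alpha>x]
    unfolding M_def by auto
  have "int (card (carrier ?H)) = 2 * M"
    using \<open>n \<ge> 1\<close> unfolding N[symmetric] \<open>N = _\<close>
    by (simp add: carrier_integer_mod_group card_cartesian_product)
  then interpret cyclic_by_involution G M s a
      "\<lambda>i. (x [^]\<^bsub>?H\<^esub> i, 0)" "\<lambda>i. (x [^]\<^bsub>?H\<^esub> i, 1)"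
    unfolding G using cyclic_by_involution_semidirect[OF H \<open>generator ?H x\<close> _ \<alpha> \<alpha>x M_pos M_even four s]
    by blast
  note spectrum = reidemeister_spectrum[OF \<open>odd n\<close> \<open>m \<ge> 2\<close> M_def]
  have pos: "d0 > 0 \<and> d1 > 0" if "(d0, d1) \<in> admissible_pairs n" for d0 d1
  proof -
    have "d0 dvd n" "d1 dvd n"
      using that by (auto simp: admissible_pairs_def D_def D'_def split: if_splits)
    then show ?thesis using \<open>n \<ge> 1\<close> by (auto intro: dvd_pos_nat)
  qed
  \<comment> \<open>The two cases of the theorem are \<open>t = 0\<close> and \<open>t = 1\<close>; they fix the parity of \<open>s\<close>.\<close>
  have shift: "[a = t * M - 1] (mod int N) \<longleftrightarrow> even (s - t)" for t
  proof -
    have "[a = t * M - 1] (mod int N) \<longleftrightarrow> M * 2 dvd M * (s - t)"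
      unfolding N s by (simp add: cong_iff_dvd_diff algebra_simps)
    then show ?thesis using M_pos by (simp only: dvd_mult_cancel_left) simp
  qed
  have dihedral: "Spec\<^sub>R G = enat ` spec_dihedral m (admissible_pairs n)" if "[a = - 1] (mod int N)"
  proof -
    have "even s" using shift[of 0] that by simp
    moreover have "spec_dihedral m (admissible_pairs n) = {2 ^ e * d0 + d1 + r | e d0 d1 r.
        1 \<le> e \<and> e \<le> m - 1 \<and> (d0, d1) \<in> admissible_pairs n \<and> (r = 2 \<or> r = 0)}"
      by (rule spec_dihedral_eq) (rule pos)
    ultimately show ?thesis unfolding spectrum by simp
  qed
  have semidihedral: "m \<ge> 3 \<and> Spec\<^sub>R G = enat ` spec_semidihedral m (admissible_pairs n)"
    if "[a = 2 ^ (m - 1) * int n - 1] (mod int N)"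
  proof
    have odd: "odd s" using shift[of 1] that unfolding M_def by simp
    then show "Spec\<^sub>R G = enat ` spec_semidihedral m (admissible_pairs n)"
      unfolding spectrum spec_semidihedral_def by simp
    show "m \<ge> 3"
    proof (rule ccontr)
      assume "\<not> m \<ge> 3"
      then have "m = 2" using \<open>m \<ge> 2\<close> by simp
      then have "4 dvd 2 * (s * int n)" using four by (simp add: M_def ac_simps)
      moreover have "even t" if "4 dvd 2 * t" for t :: int using that by presburger
      ultimately have "even (s * int n)" by blast
      then show False using odd \<open>odd n\<close> by simp
    qed
  qed
  show ?thesis
    using dihedral semidihedral by (auto simp: admissible_pairs_def)
qed

end
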